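(* There exists an effectively computable constant $c_p>0$, depending at most on the prime $p\ge3$, such that for any finite field $\mathbb{F}$ of characteristic $p$, any nontrivial additive character $\psi$ on $\mathbb{F}$ and any $\alpha\in\mathbb{F}^\times$, $$|\theta_{\mathbb{F}}(\psi;\alpha)|>|\mathbb{F}|^{-c_p}\quad\text{and}\quad|\pi-\theta_{\mathbb{F}}(\psi;\alpha)|>|\mathbb{F}|^{-c_p}.$$ Moreover, $c_p=2(p-1)$ is a suitable value.
   Context: $\psi$ takes values in $\mathbb{Q}(\zeta_p)$, viewed in $\mathbb{C}$ via a fixed complex embedding. The Kloosterman sum $\mathrm{Kl}_{\mathbb{F}}(\psi;\alpha)=-\sum_{x\in\mathbb{F}^\times}\psi(x+\alpha/x)$ is a real number with $|\mathrm{Kl}_{\mathbb{F}}(\psi;\alpha)|\le2|\mathbb{F}|^{1/2}$, and $\theta_{\mathbb{F}}(\psi;\alpha)\in[0,\pi]$ is the unique angle with $\mathrm{Kl}_{\mathbb{F}}(\psi;\alpha)=2|\mathbb{F}|^{1/2}\cos\theta_{\mathbb{F}}(\psi;\alpha)$. *)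

theory Defs
  imports Complex_Main "HOL-Computational_Algebra.Primes"
begin

definition add_char :: "('a::field \<Rightarrow> complex) \<Rightarrow> bool" where
  "add_char \<psi> \<longleftrightarrow> (\<forall>x y. \<psi> (x + y) = \<psi> x * \<psi> y) \<and> (\<forall>x. \<psi> x \<noteq> 0)"

definition nontrivial_add_char :: "('a::field \<Rightarrow> complex) \<Rightarrow> bool" where
  "nontrivial_add_char \<psi> \<longleftrightarrow> add_char \<psi> \<and> (\<exists>x. \<psi> x \<noteq> 1)"

definition kloosterman :: "('a::{field,finite} \<Rightarrow> complex) \<Rightarrow> 'a \<Rightarrow> complex" where
  "kloosterman \<psi> \<alpha> = - (\<Sum>x\<in>UNIV - {0}. \<psi> (x + \<alpha> / x))"

text \<open>The angle theta in [0, pi] with Kl = 2 |F|^(1/2) cos theta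
  (Kl is real and bounded by 2 |F|^(1/2) by Weil's bound).\<close>
definition kl_angle :: "('a::{field,finite} \<Rightarrow> complex) \<Rightarrow> 'a \<Rightarrow> real" where
  "kl_angle \<psi> \<alpha> = arccos (Re (kloosterman \<psi> \<alpha>) / (2 * sqrt (real (card (UNIV :: 'a set)))))"

end

theory Submission
  imports "HOL-Algebra.Algebraic_Closure_Type" "HOL-Computational_Algebra.Computational_Algebra" Defs
begin

text \<open>If $\zeta$ is a primitive $p$-th root of unity, then $4q - \mathrm{Kl}^2$ lies in
  $\mathbb{Z}[\zeta]$ and is a unit modulo $1 - \zeta$, because $\mathrm{Kl} \equiv 1 - q$ and $p \mid q$.
  Its norm is therefore a nonzero integer, and as all conjugates are at most $(q + 1)^2$ in
  absolute value, $4q - \mathrm{Kl}^2 = 4q \sin^2 \theta$ cannot be too small.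

  Since \<^const>\<open>arccos\<close> is unspecified outside $[-1, 1]$, the full Weil bound
  $|\mathrm{Kl}| \le 2\sqrt{q}$ is needed as well. The $L$-function of the sums over the extensions
  of degree $n$ is $1 + ST + qT^2$, so they are power sums of two numbers of product $q$, and it
  suffices to bound them by $O(q^{n/2})$ for even $n$. This follows from one-sided estimates for
  the number of $x$ with prescribed trace of $x + \alpha/x$, obtained by Stepanov's method with
  Bombieri's use of $p$-power Frobenius maps in place of derivatives.\<close>

subsection \<open>Stepanov's method for hyperelliptic curves\<close>

text \<open>The exponent 2(p - 1) is a rounding. Keeping one conjugate of 4q - Kl^2 and bounding the
  other p - 2 gives 4q sin^2 \<theta> \<ge> (q + 1)^(-2(p - 2)). With q + 1 \<le> q^2 and 4q < q^4
  this yields sin \<theta> > q^(-2(p - 1)), and sin \<theta> is a lower bound for both \<theta> and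
  pi - \<theta>. In the Weil bound the degree is even so that the extension has r^2 elements with r
  a power of q: on it the r-th power map is an involution, which lets H^r be rewritten with low
  degree. Upper bounds for the counts are enough because their total is known and the values of the
  character sum to zero. Arguing by contradiction, a sum beyond 2 sqrt q makes both reciprocal roots
  of the L-function real, so their even power sums cannot cancel.\<close>

lemma underdetermined_system:
  fixes M :: "'i \<Rightarrow> 'j \<Rightarrow> 'k::field"
  assumes "finite J" "finite I" "card J < card I"
  shows "\<exists>c. (\<exists>i\<in>I. c i \<noteq> 0) \<and> (\<forall>j\<in>J. (\<Sum>i\<in>I. c i * M i j) = 0)"
  using assms
proof (induction J arbitrary: I M rule: finite_induct)
  case empty
  then have "I \<noteq> {}" by auto
  then show ?case by (intro exI[of _ "\<lambda>_. 1"]) auto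
next
  case (insert j0 J)
  show ?case
  proof (cases "\<forall>i\<in>I. M i j0 = 0")
    case True
    obtain c where "\<exists>i\<in>I. c i \<noteq> 0" "\<forall>j\<in>J. (\<Sum>i\<in>I. c i * M i j) = 0"
      using insert.IH[of I M] insert.prems insert.hyps by auto
    with True show ?thesis by (intro exI[of _ c]) auto
  next
    case False
    then obtain i0 where i0: "i0 \<in> I" "M i0 j0 \<noteq> 0" by auto
    \<comment> \<open>Gaussian elimination: equation \<open>j0\<close> is solved for the unknown
      \<open>i0\<close>, and \<open>M'\<close> is the system that remains for the other
      unknowns.\<close>
    define M' where "M' = (\<lambda>i j. M i j - M i j0 / M i0 j0 * M i0 j)"
    obtain c where c: "\<exists>i\<in>I - {i0}. c i \<noteq> 0" "\<forall>j\<in>J. (\<Sum>i\<in>I - {i0}. c i * M' i j) = 0"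
      using insert.IH[of "I - {i0}" M'] insert.prems insert.hyps i0 by (auto simp: less_diff_conv)
    define c' where "c' = c(i0 := - (\<Sum>i\<in>I - {i0}. c i * M i j0) / M i0 j0)"
    have split: "(\<Sum>i\<in>I. c' i * M i j) =
        (\<Sum>i\<in>I - {i0}. c i * M i j) - (\<Sum>i\<in>I - {i0}. c i * M i j0) / M i0 j0 * M i0 j" for j
      using i0 insert.prems
      by (subst sum.remove[of _ i0]) (auto simp: c'_def intro!: sum.cong)
    have "(\<Sum>i\<in>I. c' i * M i j) = 0" if "j \<in> insert j0 J" for j
    proof (cases "j = j0")
      case True
      then show ?thesis using i0 by (simp add: split)
    next
      case False
      have "(\<Sum>i\<in>I. c' i * M i j) = (\<Sum>i\<in>I - {i0}. c i * M' i j)"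
        unfolding split M'_def
        by (simp add: algebra_simps sum_subtractf sum_distrib_left sum_distrib_right sum_divide_distrib)
      with c that False show ?thesis by auto
    qed
    moreover have "\<exists>i\<in>I. c' i \<noteq> 0" using c by (auto simp: c'_def)
    ultimately show ?thesis by blast
  qed
qed

text \<open>Each coefficient of \<open>B\<close> occupies exponents below r only, so after
  substituting y^r the blocks do not overlap, just like digits in base r. In this range y and y^r
  behave as independent variables.\<close>

lemma poly_poly_monom_eq_0:
  fixes B :: "'k::field poly poly"
  assumes "\<And>j. degree (coeff B j) < r" "poly B (monom 1 r) = 0"
  shows "B = 0"
  using assms
proof (induction B)
  case (pCons a B)
  have "degree a < r" using pCons.prems(1)[of 0] by simp
  have eq: "a = - (monom 1 r * poly B (monom 1 r))"
    using pCons.prems(2) by (simp add: eq_neg_iff_add_eq_0)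
  have B0: "poly B (monom 1 r) = 0"
  proof (rule ccontr)
    assume "poly B (monom 1 r) \<noteq> 0"
    then have "degree a = r + degree (poly B (monom 1 r))"
      by (subst eq) (simp add: degree_mult_eq degree_monom_eq)
    with \<open>degree a < r\<close> show False by simp
  qed
  have "B = 0"
    using pCons.prems(1)[of "Suc _"] B0 by (intro pCons.IH) auto
  moreover have "a = 0" using eq B0 by simp
  ultimately show ?case by simp
qed auto

text \<open>By the Frobenius endomorphism \<open>h ^ r\<close> is a polynomial in y^r with constant
  coefficients, so it costs no degree in y once y^r is treated as a separate variable.\<close>

lemma power_CHAR_poly:
  fixes h :: "'k::field poly"
  assumes "prime CHAR('k)" "r = CHAR('k) ^ e"
  shows "h ^ r = poly (map_poly (\<lambda>c. [:c ^ r:]) h) (monom 1 r)"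
proof -
  have r: "r > 0" using assms by (auto simp: prime_gt_0_nat)
  have ch: "prime CHAR('k poly)" using assms by simp
  have "h ^ r = (\<Sum>i\<le>degree h. monom (coeff h i) i) ^ r"
    by (simp add: poly_as_sum_of_monoms)
  also have "\<dots> = (\<Sum>i\<le>degree h. monom (coeff h i) i ^ r)"
    using ch assms by (subst freshmans_dream_sum'[of r e]) auto
  also have "\<dots> = (\<Sum>i\<le>degree h. [:coeff h i ^ r:] * monom 1 r ^ i)"
    by (intro sum.cong refl) (simp add: monom_power smult_monom mult.commute)
  also have "\<dots> = poly (map_poly (\<lambda>c. [:c ^ r:]) h) (monom 1 r)"
    using r by (subst poly_altdef)
      (auto simp: coeff_map_poly degree_map_poly intro!: sum.mono_neutral_cong_right)
  finally show ?thesis .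
qed

lemma degree_coeff_mult_le:
  fixes A B :: "'k::field poly poly"
  assumes "\<And>j. degree (coeff A j) \<le> a" "\<And>j. degree (coeff B j) \<le> b"
  shows "degree (coeff (A * B) j) \<le> a + b"
  unfolding coeff_mult
  by (intro degree_sum_le) (auto intro!: order.trans[OF degree_mult_le] add_mono assms)

text \<open>With $Y = y^r$ the relation, once squared, is an identity between polynomials in the independent
  variables $y$ and $Y$; comparing leading coefficients in $Y$ makes $h$ a square up to a constant.\<close>

lemma stepanov_independence:
  fixes h :: "'k::field poly" and A F :: "'k poly poly"
  assumes "prime CHAR('k)" "r = CHAR('k) ^ e" "odd r"
    and "odd (order \<rho> h)" "h \<noteq> 0"
    and dA: "\<And>j. degree (coeff A j) \<le> l" and dF: "\<And>j. degree (coeff F j) \<le> l"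
    and l: "2 * l + degree h < r"
    and eq: "poly A (monom 1 r) + h ^ ((r + 1) div 2) * poly F (monom 1 r) = 0"
  shows "A = 0 \<and> F = 0"
proof -
  define h' where "h' = map_poly (\<lambda>c. [:c ^ r:]) h"
  have r: "r > 0" using assms by (auto simp: prime_gt_0_nat)
  have h': "poly h' (monom 1 r) = h ^ r"
    unfolding h'_def using assms by (intro power_CHAR_poly[symmetric]) auto
  have ch': "coeff h' j = [:coeff h j ^ r:]" for j
    using r by (simp add: h'_def coeff_map_poly)
  have h'0: "h' \<noteq> 0"
  proof
    assume "h' = 0"
    then have "coeff h' (degree h) = 0" by simp
    with ch'[of "degree h"] assms show False by simp
  qed
  \<comment> \<open>This is A^2 - h^(r + 1) F^2 with the factor h^r moved into the variable Y. Only
    one factor \<open>h\<close> remains in y, so the coefficients have degree at most 2l + deg h,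
    which is below r.\<close>
  define B where "B = A * A - [:h:] * (h' * (F * F))"
  have "poly A (monom 1 r) = - (h ^ ((r + 1) div 2) * poly F (monom 1 r))"
    using eq by (simp add: eq_neg_iff_add_eq_0)
  then have "poly A (monom 1 r) * poly A (monom 1 r) =
      (h ^ ((r + 1) div 2) * h ^ ((r + 1) div 2)) * (poly F (monom 1 r) * poly F (monom 1 r))"
    by (simp add: algebra_simps)
  also have "h ^ ((r + 1) div 2) * h ^ ((r + 1) div 2) = h * h ^ r"
  proof -
    have "(r + 1) div 2 + (r + 1) div 2 = Suc r" using \<open>odd r\<close> by presburger
    then show ?thesis by (metis power_add power_Suc)
  qed
  finally have "poly B (monom 1 r) = 0"
    by (simp add: B_def h' mult_ac)
  moreover have "degree (coeff B j) < r" for j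
  proof -
    have 1: "degree (coeff (A * A) j) \<le> l + l" by (intro degree_coeff_mult_le dA)
    have "degree (coeff ([:h:] * (h' * (F * F))) j) \<le> degree h + (0 + (l + l))"
      by (intro degree_coeff_mult_le dF) (auto simp: ch' coeff_pCons split: nat.split)
    with 1 have "degree (coeff B j) \<le> 2 * l + degree h"
      unfolding B_def coeff_diff by (intro degree_diff_le) auto
    with l show ?thesis by simp
  qed
  ultimately have "B = 0" by (intro poly_poly_monom_eq_0[of B r]) auto
  then have AF: "A * A = [:h:] * (h' * (F * F))" by (simp add: B_def)
  have "F = 0"
  proof (rule ccontr)
    assume F: "F \<noteq> 0"
    with AF h'0 assms have A: "A \<noteq> 0" by auto
    have "lead_coeff A * lead_coeff A = h * (lead_coeff h' * (lead_coeff F * lead_coeff F))"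
      using arg_cong[OF AF, of lead_coeff] by (simp only: lead_coeff_mult) simp
    moreover obtain s where s: "lead_coeff h' = [:s:]" "s \<noteq> 0"
      using h'0 by (metis ch' leading_coeff_0_iff pCons_0_0)
    ultimately have "order \<rho> (lead_coeff A * lead_coeff A) =
        order \<rho> (h * (smult s (lead_coeff F * lead_coeff F)))" by simp
    then have "2 * order \<rho> (lead_coeff A) = order \<rho> h + 2 * order \<rho> (lead_coeff F)"
      using A F s assms by (simp add: order_mult order_smult)
    with \<open>odd (order \<rho> h)\<close> show False by presburger
  qed
  with AF show ?thesis by simp
qed

section \<open>Counting points with an auxiliary polynomial\<close>

definition bipoly :: "nat \<Rightarrow> nat \<Rightarrow> (nat \<times> nat \<Rightarrow> 'k::field) \<Rightarrow> 'k poly poly" where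
  "bipoly l k c = (\<Sum>j<k. monom (\<Sum>i<l. monom (c (i, j)) i) j)"

lemma coeff_bipoly: "coeff (coeff (bipoly l k c) j) i = (if i < l \<and> j < k then c (i, j) else 0)"
proof -
  have "coeff (bipoly l k c) j = (if j < k then (\<Sum>i<l. monom (c (i, j)) i) else 0)"
    by (simp add: bipoly_def coeff_sum coeff_monom)
  then show ?thesis by (simp add: coeff_sum coeff_monom)
qed

lemma degree_coeff_bipoly: "degree (coeff (bipoly l k c) j) \<le> l - 1"
  by (rule degree_le) (auto simp: coeff_bipoly)

lemma poly_bipoly:
  "poly (poly (bipoly l k c) (monom 1 r)) y = (\<Sum>(i, j)\<in>{..<l} \<times> {..<k}. c (i, j) * y ^ (i + r * j))"
  unfolding sum.cartesian_product[symmetric]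
  by (subst sum.swap)
     (simp add: bipoly_def poly_sum poly_monom sum_distrib_right sum_distrib_left power_add power_mult[symmetric] mult_ac)

lemma degree_poly_bipoly: "degree (poly (bipoly l k c) (monom 1 r)) \<le> (l - 1) + r * (k - 1)"
  unfolding bipoly_def poly_sum poly_monom monom_power
proof (intro degree_sum_le)
  fix j assume "j \<in> {..<k}"
  have "degree (\<Sum>i<l. monom (c (i, j)) i) \<le> l - 1"
    by (rule degree_le) (auto simp: coeff_sum coeff_monom)
  moreover have "degree (monom (1 ^ j :: 'a) (r * j)) \<le> r * (k - 1)"
    using \<open>j \<in> _\<close> by (intro order.trans[OF degree_monom_le]) auto
  ultimately show "degree ((\<Sum>i<l. monom (c (i, j)) i) * monom (1 ^ j) (r * j)) \<le> l - 1 + r * (k - 1)"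
    by (intro order.trans[OF degree_mult_le] add_mono)
qed auto

text \<open>The auxiliary polynomial is $H = A(y, y^r) + h^{(r+1)/2} F(y, y^r)$. On the points in question
  $H^r$ agrees with a polynomial $\Phi$ of much lower degree whose coefficients are linear in the $r$-th
  powers of the coefficients of $A$ and $F$; these can be chosen to make $\Phi$ vanish.\<close>

lemma stepanov_bound:
  fixes h :: "'k::alg_closed_field poly"
  assumes ch: "prime CHAR('k)" "r = CHAR('k) ^ e" and "odd r"
    and deg: "degree h = 2 * d" "d \<ge> 1" and rho: "odd (order \<rho> h)" and rd: "6 * d \<le> r"
  shows "2 * card {y. y ^ (r * r) = y \<and> poly h y ^ ((r * r - 1) div 2) = 1} \<le> r * r + 4 * d * r"
proof -
  have r0: "r > 0" using assms by (auto simp: prime_gt_0_nat)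
  \<comment> \<open>All parameters are expressed by d and s, where r = 2(3d + s) + 1.
    \<open>l\<close> is the largest value with 2(l - 1) + 2d < r, as independence requires.
    \<open>k\<close> is about r/2 + d: the l(2k + d) unknowns then exceed the \<open>E\<close>
    conditions by d(s + 1), while deg H stays near r^2/2 + 2dr. The d extra powers of y^r in A match
    the degree 2dR, about dr, that \<open>h ^ R\<close> adds to the other term.\<close>
  define s where "s = (r - 1) div 2 - 3 * d"
  have r_eq: "r = 2 * (3 * d + s) + 1" using \<open>odd r\<close> rd unfolding s_def by presburger
  define R where "R = 3 * d + 1 + s"
  have R: "(r + 1) div 2 = R" unfolding R_def r_eq by simp
  define l where "l = 2 * d + 1 + s"
  define k where "k = 4 * d + s"
  define I where "I = ({..<l} \<times> {..<k + d}) <+> ({..<l} \<times> {..<k})"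
  \<comment> \<open>One more than the largest degree among the terms containing
    \<open>h ^ R\<close>, hence the number of coefficients of \<Phi> that must vanish.\<close>
  define E where "E = r * (R - 1) + k + d"
  \<comment> \<open>The r-th power of y^(i + rj) is y^(ir + r^2 j), which equals y^(ir + j) at the
    points to be counted.\<close>
  define mon where "mon = (\<lambda>x. case x of Inl (i, j) \<Rightarrow> monom 1 (i * r + j)
                                | Inr (i, j) \<Rightarrow> h ^ R * (monom 1 (i * r + j) :: 'k poly))"
  have [simp]: "finite I" by (simp add: I_def)
  have "card I = l * (k + d) + l * k"
    unfolding I_def by (subst card_Plus) (auto simp: card_cartesian_product)
  also have "\<dots> > E"
    using deg unfolding E_def l_def k_def R_def r_eq by (simp add: algebra_simps)
  finally obtain c0 where c0: "\<exists>i\<in>I. c0 i \<noteq> 0"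
      and c0': "\<forall>j\<in>{..<E}. (\<Sum>i\<in>I. c0 i * coeff (mon i) j) = 0"
    using underdetermined_system[of "{..<E}" I "\<lambda>i j. coeff (mon i) j"] by auto
  define \<Phi> where "\<Phi> = (\<Sum>i\<in>I. smult (c0 i) (mon i))"
  have deg_mon: "degree (mon i) < E" if iI: "i \<in> I" for i
  proof -
    have *: "i * r + j \<le> r * (l - 1) + m - 1" if "i < l" "j < m" for i j m
    proof -
      have "i * r \<le> (l - 1) * r" using that by (intro mult_right_mono) auto
      then show ?thesis using that unfolding mult.commute[of r] by linarith
    qed
    show ?thesis
    proof (cases i)
      case (Inl x)
      then obtain a b where ab: "i = Inl (a, b)" "a < l" "b < k + d" using iI by (cases x) (auto simp: I_def)
      have "degree (mon i) = a * r + b" by (simp add: ab mon_def degree_monom_eq)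
      also have "\<dots> \<le> r * (l - 1) + (k + d) - 1" using ab by (intro *)
      also have "\<dots> < E"
        using deg unfolding E_def l_def R_def k_def by (simp add: algebra_simps)
      finally show ?thesis .
    next
      case (Inr x)
      then obtain a b where ab: "i = Inr (a, b)" "a < l" "b < k" using iI by (cases x) (auto simp: I_def)
      have "degree (mon i) \<le> 2 * d * R + (a * r + b)"
        unfolding mon_def ab using deg
        by (auto intro!: order.trans[OF degree_mult_le] add_mono order.trans[OF degree_power_le] simp: degree_monom_eq)
      also have "a * r + b \<le> r * (l - 1) + k - 1" using ab by (intro *)
      also have "2 * d * R + (r * (l - 1) + k - 1) < E"
        using deg unfolding E_def l_def R_def k_def r_eq by (simp add: algebra_simps)
      finally show ?thesis by simp
    qed
  qed
  have "\<Phi> = 0"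
  proof (rule poly_eqI)
    fix j
    show "coeff \<Phi> j = coeff 0 j"
    proof (cases "j < E")
      case True
      then show ?thesis using c0' by (simp add: \<Phi>_def coeff_sum)
    next
      case False
      then have "coeff (mon i) j = 0" if "i \<in> I" for i
        using deg_mon[OF that] by (intro coeff_eq_0) auto
      then show ?thesis by (simp add: \<Phi>_def coeff_sum)
    qed
  qed
  \<comment> \<open>The linear system was solved for the r-th powers of the coefficients; the
    coefficients themselves are r-th roots, available in an algebraically closed field.\<close>
  have "\<exists>c. \<forall>i. c i ^ r = c0 i" by (intro choice allI nth_root_exists r0)
  then obtain c where c: "\<And>i. c i ^ r = c0 i" by blast
  define A where "A = bipoly l (k + d) (\<lambda>x. c (Inl x))"
  define F where "F = bipoly l k (\<lambda>x. c (Inr x))"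
  define H where "H = poly A (monom 1 r) + h ^ R * poly F (monom 1 r)"
  have "H \<noteq> 0"
  proof
    assume H: "H = 0"
    have "A = 0 \<and> F = 0"
    proof (rule stepanov_independence[OF ch \<open>odd r\<close> rho])
      show "h \<noteq> 0" using deg by auto
      show "degree (coeff A j) \<le> l - 1" "degree (coeff F j) \<le> l - 1" for j
        unfolding A_def F_def by (rule degree_coeff_bipoly)+
      show "2 * (l - 1) + degree h < r" using deg unfolding l_def r_eq by simp
      show "poly A (monom 1 r) + h ^ ((r + 1) div 2) * poly F (monom 1 r) = 0"
        using H by (simp only: R H_def)
    qed
    then have A0: "coeff (coeff A j) i = 0" and F0: "coeff (coeff F j) i = 0" for i j by auto
    have "c x = 0" if "x \<in> I" for x
      using that A0[of "snd (projl x)" "fst (projl x)"] F0[of "snd (projr x)" "fst (projr x)"]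
      by (auto simp: I_def A_def F_def coeff_bipoly)
    with c0 c r0 show False by (metis power_0_left less_numeral_extra(3))
  qed
  have deg_H: "2 * degree H \<le> r * r + 4 * d * r"
  proof -
    have "degree H \<le> max ((l - 1) + r * (k + d - 1)) (2 * d * R + ((l - 1) + r * (k - 1)))"
      unfolding H_def
    proof (rule degree_add_le_max[THEN order.trans], rule max.mono)
      show "degree (poly A (monom 1 r)) \<le> l - 1 + r * (k + d - 1)"
        unfolding A_def by (rule degree_poly_bipoly)
      show "degree (h ^ R * poly F (monom 1 r)) \<le> 2 * d * R + (l - 1 + r * (k - 1))"
        unfolding F_def using deg
        by (intro order.trans[OF degree_mult_le] add_mono order.trans[OF degree_power_le] degree_poly_bipoly) auto
    qed
    moreover have "2 * ((l - 1) + r * (k + d - 1)) \<le> r * r + 4 * d * r"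
    proof -
      obtain d' where "d = Suc d'" using deg by (cases d) auto
      then show ?thesis unfolding l_def k_def r_eq by (simp add: algebra_simps)
    qed
    moreover have "2 * (2 * d * R + ((l - 1) + r * (k - 1))) \<le> r * r + 4 * d * r"
    proof -
      obtain d' where "d = Suc d'" using deg by (cases d) auto
      then show ?thesis unfolding l_def k_def R_def r_eq by (simp add: algebra_simps)
    qed
    ultimately show ?thesis unfolding max_def by (auto split: if_splits)
  qed
  have root: "poly H y = 0" if y: "y ^ (r * r) = y" and hy: "poly h y ^ ((r * r - 1) div 2) = 1" for y
  proof -
    \<comment> \<open>Since Rr = (r^2 - 1)/2 + R, the condition on h(y) makes h(y)^R invariant under
      the r-th power, so this factor keeps its low degree.\<close>
    have hyR: "(poly h y ^ R) ^ r = poly h y ^ R"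
    proof -
      have "R * r = (r * r - 1) div 2 + R" unfolding R_def r_eq by (simp add: algebra_simps)
      then have "(poly h y ^ R) ^ r = poly h y ^ ((r * r - 1) div 2 + R)" by (simp flip: power_mult)
      then show ?thesis using hy by (simp add: power_add)
    qed
    have yy: "(y ^ (i + r * j)) ^ r = y ^ (i * r + j)" for i j
    proof -
      have "(y ^ (i + r * j)) ^ r = y ^ (i * r) * (y ^ (r * r)) ^ j"
        by (simp add: power_add power_mult_distrib mult_ac flip: power_mult)
      then show ?thesis by (simp add: y power_add)
    qed
    have evA: "poly (poly (bipoly l m f) (monom 1 r)) y ^ r = (\<Sum>(i, j)\<in>{..<l} \<times> {..<m}. f (i, j) ^ r * y ^ (i * r + j))"
      for m f
      unfolding poly_bipoly freshmans_dream_sum'[OF ch]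
      by (intro sum.cong refl) (auto simp: power_mult_distrib yy)
    have "poly H y ^ r = poly (poly A (monom 1 r)) y ^ r + poly h y ^ R * poly (poly F (monom 1 r)) y ^ r"
      by (simp add: H_def freshmans_dream'[OF ch] power_mult_distrib hyR)
    also have "\<dots> = poly \<Phi> y"
      unfolding A_def F_def evA c \<Phi>_def I_def poly_sum
      by (simp add: sum.Plus mon_def poly_monom case_prod_unfold sum_distrib_left mult_ac)
    finally show ?thesis using \<open>\<Phi> = 0\<close> r0 by simp
  qed
  have "card {y. y ^ (r * r) = y \<and> poly h y ^ ((r * r - 1) div 2) = 1} \<le> card {y. poly H y = 0}"
    using root \<open>H \<noteq> 0\<close> by (intro card_mono poly_roots_finite) auto
  also have "\<dots> \<le> degree H" by (rule card_poly_roots_bound) fact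
  finally show ?thesis using deg_H by linarith
qed

subsection \<open>The $L$-function of Kloosterman sums\<close>

lemma sum_order_eq_degree:
  fixes h :: "'k::alg_closed_field poly"
  assumes "h \<noteq> 0"
  shows "(\<Sum>x\<in>{x. poly h x = 0}. order x h) = degree h"
proof -
  obtain A where A: "size A = degree h" "h = smult (lead_coeff h) (\<Prod>x\<in>#A. [:-x, 1:])"
    using alg_closed_imp_factorization[OF assms] by blast
  have "proots (\<Prod>x\<in>#A. [:-x, 1:]) = A"
  proof (induction A)
    case (add x A)
    have "(\<Prod>x\<in>#A. [:-x, 1:]) \<noteq> 0" by (auto simp: prod_mset_zero_iff)
    then show ?case using add by (simp add: proots_mult del: mult_pCons_left)
  qed auto
  then have "proots h = A"
    using A(2) assms by (metis leading_coeff_0_iff proots_smult)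
  then have "size (proots h) = degree h" using A by simp
  then show ?thesis using assms by (simp add: size_multiset_overloaded_eq)
qed

lemma order_eq_1_if_pderiv:
  fixes h :: "'k::field poly"
  assumes "h \<noteq> 0" "poly h x = 0" "poly (pderiv h) x \<noteq> 0"
  shows "order x h = 1"
proof (rule ccontr)
  assume "order x h \<noteq> 1"
  with assms have "2 \<le> order x h"
    by (metis One_nat_def Suc_1 Suc_leI le_neq_implies_less less_one linorder_not_less order_root)
  then have "[:-x, 1:] ^ 2 dvd h" by (simp add: order_divides)
  then obtain g where "h = [:-x, 1:] * ([:-x, 1:] * g)" by (metis dvdE power2_eq_square mult.assoc)
  then have "poly (pderiv h) x = 0" by (simp only: pderiv_mult poly_mult poly_add) simp
  with assms(3) show False by simp
qed

lemma card_roots_eq_degree: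
  fixes h :: "'k::alg_closed_field poly"
  assumes "h \<noteq> 0" "\<And>x. poly h x = 0 \<Longrightarrow> poly (pderiv h) x \<noteq> 0"
  shows "card {x. poly h x = 0} = degree h"
proof -
  have "order x h = 1" if "poly h x = 0" for x
    by (rule order_eq_1_if_pderiv[OF assms(1) that assms(2)[OF that]])
  then show ?thesis
    using sum_order_eq_degree[OF assms(1)] by simp
qed

lemma prod_linear_dvd:
  fixes g :: "'k::field poly"
  assumes "finite A" "\<And>a. a \<in> A \<Longrightarrow> poly g a = 0"
  shows "(\<Prod>a\<in>A. [:-a, 1:]) dvd g"
  using assms
proof (induction A arbitrary: g rule: finite_induct)
  case (insert a A)
  then obtain k where k: "g = [:-a, 1:] * k" by (metis dvdE insertI1 poly_eq_0_iff_dvd)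
  have "poly k b = 0" if "b \<in> A" for b
    using insert.prems[of b] insert.hyps that by (auto simp: k)
  then have "(\<Prod>a\<in>A. [:-a, 1:]) dvd k" by (rule insert.IH)
  then show ?case using insert.hyps by (simp add: k del: mult_pCons_left)
qed auto

text \<open>The field of q elements is the fixed field of x -> x^q in an algebraically closed field,
  so that all its finite extensions are subsets of one type. The conditions on \<open>\<chi>\<close>
  concern this fixed field, so any continuation of a character to a total function
  qualifies.\<close>

locale kloosterman_char =
  fixes q e :: nat and \<chi> :: "'k::alg_closed_field \<Rightarrow> complex" and \<alpha> :: 'k
  assumes prime_CHAR: "prime CHAR('k)" and q_def: "q = CHAR('k) ^ e" and e_pos: "e > 0"
    and \<chi>_0: "\<chi> 0 = 1"
    and \<chi>_add: "\<And>x y. x ^ q = x \<Longrightarrow> y ^ q = y \<Longrightarrow> \<chi> (x + y) = \<chi> x * \<chi> y"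
    and \<chi>_nontrivial: "\<exists>x. x ^ q = x \<and> \<chi> x \<noteq> 1"
    and \<alpha>_rational: "\<alpha> ^ q = \<alpha>" and \<alpha>_nz: "\<alpha> \<noteq> 0"
begin

lemma q_gt_1: "q > 1"
  unfolding q_def using prime_CHAR e_pos by (intro one_less_power prime_gt_1_nat)

lemma qn_pos: "q ^ n > 0"
  using q_gt_1 by simp

lemma qn_CHAR: "q ^ n = CHAR('k) ^ (e * n)"
  by (simp add: q_def power_mult)

lemma frob_add: "(x + y :: 'k) ^ (q ^ n) = x ^ (q ^ n) + y ^ (q ^ n)"
  by (rule freshmans_dream'[OF prime_CHAR qn_CHAR])

lemma frob_sum: "sum f A ^ (q ^ n) = (\<Sum>x\<in>A. (f x :: 'k) ^ (q ^ n))"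
  by (rule freshmans_dream_sum'[OF prime_CHAR qn_CHAR])

lemma frob_minus: "(- x :: 'k) ^ (q ^ n) = - (x ^ (q ^ n))"
  using frob_add[of x "- x" n] q_gt_1 by (simp add: power_0_left eq_neg_iff_add_eq_0 add.commute)

lemma frob_diff: "(x - y :: 'k) ^ (q ^ n) = x ^ (q ^ n) - y ^ (q ^ n)"
  using frob_add[of x "- y" n] by (simp add: frob_minus)

lemma frob_inj: "(x :: 'k) ^ (q ^ n) = y ^ (q ^ n) \<Longrightarrow> x = y"
  using frob_diff[of x y n] by simp

lemma frob_sum1: "sum f A ^ q = (\<Sum>x\<in>A. (f x :: 'k) ^ q)"
  using frob_sum[of f A 1] by simp

lemma frob_frob: "((x :: 'k) ^ (q ^ m)) ^ (q ^ n) = x ^ (q ^ (m + n))"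
  by (simp add: power_add flip: power_mult)

lemma frob_Suc: "(x :: 'k) ^ (q ^ Suc n) = (x ^ (q ^ n)) ^ q"
  by (metis power_Suc2 power_mult)

lemma frob_rational: "(x :: 'k) ^ q = x \<Longrightarrow> x ^ (q ^ n) = x"
  by (induction n) (auto simp: power_mult)

lemma rational_add: "x ^ q = x \<Longrightarrow> y ^ q = y \<Longrightarrow> (x + y :: 'k) ^ q = x + y"
  using frob_add[of x y 1] by simp

lemma rational_minus: "x ^ q = x \<Longrightarrow> (- x :: 'k) ^ q = - x"
  using frob_minus[of x 1] by simp

lemma rational_diff: "x ^ q = x \<Longrightarrow> y ^ q = y \<Longrightarrow> (x - y :: 'k) ^ q = x - y"
  using frob_diff[of x y 1] by simp

lemma rational_mult: "x ^ q = x \<Longrightarrow> y ^ q = y \<Longrightarrow> (x * y :: 'k) ^ q = x * y"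
  by (simp add: power_mult_distrib)

lemma rational_divide: "x ^ q = x \<Longrightarrow> y ^ q = y \<Longrightarrow> (x / y :: 'k) ^ q = x / y"
  by (simp add: power_divide)

lemmas rational_intros = rational_add rational_minus rational_diff rational_mult rational_divide \<alpha>_rational

text \<open>The derivative -1 makes the polynomial separable, so y^(q^n) - y = w has exactly q^n
  solutions. This counts both the fixed fields and the fibres of the Artin-Schreier map.\<close>

lemma frob_minus_id_poly:
  fixes w :: 'k
  assumes "n > 0"
  defines "h \<equiv> monom 1 (q ^ n) - monom 1 1 + [:w:] :: 'k poly"
  shows "degree h = q ^ n" "h \<noteq> 0" "pderiv h = - 1" "poly h y = y ^ (q ^ n) - y + w"
proof -
  have qn: "q ^ n > 1" using q_gt_1 assms(1) by (intro one_less_power)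
  have "coeff h (q ^ n) = 1" using qn q_gt_1 by (simp add: h_def coeff_pCons split: nat.split)
  then show "h \<noteq> 0" by auto
  have "degree h \<le> q ^ n" unfolding h_def using qn
    by (intro degree_diff_le degree_add_le) (auto simp: degree_monom_eq)
  with \<open>coeff h (q ^ n) = 1\<close> show "degree h = q ^ n"
    using le_degree[of h "q ^ n"] by (intro antisym) auto
  have "CHAR('k) dvd q ^ n" using assms(1) e_pos by (simp add: qn_CHAR)
  then have "of_nat (q ^ n) = (0 :: 'k)" by (simp only: of_nat_eq_0_iff_char_dvd)
  then show "pderiv h = - 1"
    by (simp add: h_def pderiv_diff pderiv_add pderiv_monom pderiv_pCons del: of_nat_power)
  show "poly h y = y ^ (q ^ n) - y + w" by (simp add: h_def poly_monom)
qed

lemma card_frob_minus_id: "card {y :: 'k. y ^ (q ^ n) - y = w} = q ^ n" if "n > 0"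
  using card_roots_eq_degree[of "monom 1 (q ^ n) - monom 1 1 + [:- w:]"] frob_minus_id_poly[OF that, of "- w"]
  by simp

lemma card_fixed: "card {x :: 'k. x ^ (q ^ n) = x} = q ^ n" if "n > 0"
  using card_frob_minus_id[OF that, of 0] by simp

lemma finite_fixed: "n > 0 \<Longrightarrow> finite {x :: 'k. x ^ (q ^ n) = x}"
  using card_fixed[of n] qn_pos[of n] by (metis card.infinite less_irrefl)

lemma finite_rational: "finite {x :: 'k. x ^ q = x}"
  using finite_fixed[of 1] by simp

section \<open>Sums over extensions and monic polynomials over the fixed field\<close>

definition trace :: "nat \<Rightarrow> 'k \<Rightarrow> 'k" where
  "trace n x = (\<Sum>i<n. x ^ (q ^ i))"

definition pts :: "nat \<Rightarrow> 'k set" where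
  "pts n = {x. x \<noteq> 0 \<and> x ^ (q ^ n) = x}"

text \<open>The sum over the extension of degree n, with the character lifted by the trace and
  without the minus sign of \<open>kloosterman\<close>.\<close>

definition psum :: "nat \<Rightarrow> complex" where
  "psum n = (\<Sum>x\<in>pts n. \<chi> (trace n (x + \<alpha> / x)))"

text \<open>Having coefficients in the field of q elements is phrased as invariance under a ring
  endomorphism, so products and exact quotients need only its multiplicativity.\<close>

definition rational_poly :: "'k poly \<Rightarrow> bool" where
  "rational_poly h \<longleftrightarrow> map_poly (\<lambda>c. c ^ q) h = h"

text \<open>These are the effective divisors of degree n on the multiplicative group; the condition
  at 0 excludes the pole of x + \<alpha> / x.\<close>

definition monics :: "nat \<Rightarrow> 'k poly set" where
  "monics n = {h. rational_poly h \<and> lead_coeff h = 1 \<and> degree h = n \<and> coeff h 0 \<noteq> 0}"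

text \<open>If $h = \prod_i (X - a_i)$, the argument of \<open>\<chi>\<close> is $\sum_i (a_i + \alpha / a_i)$.\<close>

definition weight :: "'k poly \<Rightarrow> complex" where
  "weight h = \<chi> (- coeff (reflect_poly h) 1 - \<alpha> * coeff h 1 / coeff h 0)"

text \<open>The coefficient of $T^n$ in the $L$-function.\<close>

definition lcoeff :: "nat \<Rightarrow> complex" where
  "lcoeff n = (\<Sum>h\<in>monics n. weight h)"

text \<open>For x in the extension of degree n, a power of its minimal polynomial: each conjugate is
  repeated if x lies in a smaller extension.\<close>

definition charpoly :: "nat \<Rightarrow> 'k \<Rightarrow> 'k poly" where
  "charpoly n x = (\<Prod>i<n. [:- (x ^ (q ^ i)), 1:])"

lemma finite_pts: "n > 0 \<Longrightarrow> finite (pts n)"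
  unfolding pts_def by (rule finite_subset[OF _ finite_fixed]) auto

lemma rational_poly_iff: "rational_poly h \<longleftrightarrow> (\<forall>i. coeff h i ^ q = coeff h i)"
  using q_gt_1 by (simp add: rational_poly_def poly_eq_iff coeff_map_poly)

lemma map_frob_mult:
  "map_poly (\<lambda>c. c ^ q) (f * g :: 'k poly) = map_poly (\<lambda>c. c ^ q) f * map_poly (\<lambda>c. c ^ q) g"
  using q_gt_1
  by (intro poly_eqI) (simp add: coeff_map_poly coeff_mult power_mult_distrib frob_sum1)

lemma map_frob_prod:
  "map_poly (\<lambda>c. c ^ q) (prod f A :: 'k poly) = (\<Prod>x\<in>A. map_poly (\<lambda>c. c ^ q) (f x))"
  using q_gt_1 by (induction A rule: infinite_finite_induct) (auto simp: map_frob_mult)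

lemma rational_poly_mult: "rational_poly f \<Longrightarrow> rational_poly g \<Longrightarrow> rational_poly (f * g)"
  by (simp add: rational_poly_def map_frob_mult)

lemma rational_poly_cancel:
  assumes "rational_poly (f * g)" "rational_poly f" "f \<noteq> 0"
  shows "rational_poly g"
  using assms by (simp add: rational_poly_def map_frob_mult)

lemma poly_frob:
  assumes "rational_poly h"
  shows "poly h (x ^ q) = poly h x ^ q"
  using assms
  by (simp add: rational_poly_iff poly_altdef frob_sum1 power_mult_distrib mult.commute flip: power_mult)

lemma poly_frob_power:
  assumes "rational_poly h"
  shows "poly h (x ^ (q ^ n)) = poly h x ^ (q ^ n)"
proof (induction n)
  case (Suc n)
  then show ?case by (simp only: frob_Suc poly_frob[OF assms])
qed auto

lemma monics_mult:
  assumes "f \<in> monics a" "g \<in> monics b"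
  shows "f * g \<in> monics (a + b)"
  using assms unfolding monics_def
  by (auto simp: rational_poly_mult lead_coeff_mult degree_mult_eq coeff_mult_0 simp flip: leading_coeff_0_iff
       simp del: leading_coeff_0_iff)

lemma monics_cancel:
  assumes "f * g \<in> monics n" "f \<in> monics a"
  shows "g \<in> monics (n - a) \<and> a \<le> n"
proof -
  have f: "rational_poly f" "lead_coeff f = 1" "degree f = a" "f \<noteq> 0" using assms by (auto simp: monics_def)
  have fg: "rational_poly (f * g)" "lead_coeff (f * g) = 1" "degree (f * g) = n" "coeff (f * g) 0 \<noteq> 0" "g \<noteq> 0"
    using assms by (auto simp: monics_def)
  have "degree (f * g) = a + degree g" using f fg by (simp add: degree_mult_eq)
  moreover have "lead_coeff g = 1" using fg(2) f(2) unfolding lead_coeff_mult by simp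
  ultimately show ?thesis
    using f fg rational_poly_cancel[of f g] by (auto simp: monics_def coeff_mult_0)
qed

text \<open>The ratio of the linear to the constant coefficient is additive under products. The
  weight uses it for h and for the reversal of h, whose constant coefficient is 1 because h is
  monic.\<close>

lemma weight_mult:
  assumes "f \<in> monics a" "g \<in> monics b"
  shows "weight (f * g) = weight f * weight g"
proof -
  have rat: "coeff f i ^ q = coeff f i" "coeff g i ^ q = coeff g i"
      "coeff (reflect_poly f) i ^ q = coeff (reflect_poly f) i"
      "coeff (reflect_poly g) i ^ q = coeff (reflect_poly g) i" for i
    using assms q_gt_1 by (auto simp: monics_def rational_poly_iff coeff_reflect_poly)
  have 0: "coeff f 0 \<noteq> 0" "coeff g 0 \<noteq> 0" "lead_coeff f = 1" "lead_coeff g = 1"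
    using assms by (auto simp: monics_def)
  have "coeff (reflect_poly (f * g)) 1 = coeff (reflect_poly f) 1 + coeff (reflect_poly g) 1"
    using 0 by (simp add: reflect_poly_mult coeff_mult)
  moreover have "coeff (f * g) 1 / coeff (f * g) 0 = coeff f 1 / coeff f 0 + coeff g 1 / coeff g 0"
    using 0 by (simp add: coeff_mult field_simps)
  ultimately have "weight (f * g) = \<chi> ((- coeff (reflect_poly f) 1 - \<alpha> * coeff f 1 / coeff f 0) +
      (- coeff (reflect_poly g) 1 - \<alpha> * coeff g 1 / coeff g 0))"
    unfolding weight_def by (simp add: algebra_simps flip: times_divide_eq_right)
  also have "\<dots> = weight f * weight g"
    unfolding weight_def by (rule \<chi>_add) (intro rational_intros rat)+
  finally show ?thesis .
qed

lemma coeffs_prod_linear: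
  fixes a :: "nat \<Rightarrow> 'k" and n :: nat
  assumes "\<And>i. a i \<noteq> 0"
  defines "h \<equiv> (\<Prod>i<n. [:- a i, 1:])"
  shows "coeff h 0 \<noteq> 0" "coeff h 1 / coeff h 0 = - (\<Sum>i<n. 1 / a i)"
    "coeff (reflect_poly h) 1 = - (\<Sum>i<n. a i)" "lead_coeff h = 1" "degree h = n"
proof -
  have *: "lead_coeff (\<Prod>i<n. [:- a i, 1:]) = 1" "degree (\<Prod>i<n. [:- a i, 1:]) = n" for n
    by (simp add: lead_coeff_prod, subst degree_prod_eq_sum_degree) auto
  then show "lead_coeff h = 1" "degree h = n" by (simp_all add: h_def)
  have "coeff h 0 \<noteq> 0 \<and> coeff h 1 / coeff h 0 = - (\<Sum>i<n. 1 / a i) \<and>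
      coeff (reflect_poly h) 1 = - (\<Sum>i<n. a i)"
    unfolding h_def
  proof (induction n)
    case (Suc n)
    define g where "g = (\<Prod>i<n. [:- a i, 1:])"
    have g: "(\<Prod>i<Suc n. [:- a i, 1:]) = [:- a n, 1:] * g" by (simp add: g_def mult.commute)
    have r: "reflect_poly [:- a n, 1:] = [:1, - a n:]"
      using assms by (simp add: reflect_poly_def)
    have lg: "lead_coeff g = 1" using * by (simp add: g_def)
    have "coeff g 1 = - (coeff g 0 * (\<Sum>i<n. 1 / a i))"
      using Suc unfolding g_def[symmetric]
      by (metis mult.commute mult_minus_left nonzero_mult_div_cancel_left times_divide_eq_right)
    with Suc assms lg show ?case
      unfolding g g_def[symmetric] reflect_poly_mult r by (simp add: coeff_mult field_simps)
  qed auto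
  then show "coeff h 0 \<noteq> 0" "coeff h 1 / coeff h 0 = - (\<Sum>i<n. 1 / a i)"
    "coeff (reflect_poly h) 1 = - (\<Sum>i<n. a i)" by auto
qed

text \<open>Raising coefficients to the q-th power permutes the linear factors cyclically, the last
  one returning to the first because x^(q^n) = x.\<close>

lemma charpoly_rational:
  assumes "x ^ (q ^ n) = x"
  shows "rational_poly (charpoly n x)"
proof (cases n)
  case (Suc m)
  have "map_poly (\<lambda>c. c ^ q) (charpoly n x) = (\<Prod>i<n. [:- (x ^ (q ^ Suc i)), 1:])"
    unfolding charpoly_def map_frob_prod using q_gt_1 frob_minus[of _ 1]
    by (intro prod.cong refl) (simp add: map_poly_pCons mult.commute flip: power_mult)
  also have "\<dots> = charpoly n x"
  proof -
    define f where "f = (\<lambda>i. [:- (x ^ (q ^ i)), 1:])"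
    have "(\<Prod>i<Suc m. f (Suc i)) = f (Suc m) * (\<Prod>i<m. f (Suc i))" by (simp add: mult.commute)
    also have "f (Suc m) = f 0" using assms Suc by (simp add: f_def)
    also have "f 0 * (\<Prod>i<m. f (Suc i)) = (\<Prod>i<Suc m. f i)" by (simp only: prod.lessThan_Suc_shift)
    finally show ?thesis by (simp only: charpoly_def f_def Suc)
  qed
  finally show ?thesis by (simp add: rational_poly_def)
qed (simp add: charpoly_def rational_poly_def)

lemma charpoly_monics:
  assumes "x \<in> pts n"
  shows "charpoly n x \<in> monics n"
  using assms coeffs_prod_linear[of "\<lambda>i. x ^ (q ^ i)" n] charpoly_rational[of x n]
  by (auto simp: monics_def pts_def charpoly_def)

lemma weight_charpoly:
  assumes "x \<in> pts n"
  shows "weight (charpoly n x) = \<chi> (trace n (x + \<alpha> / x))"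
proof -
  have x: "x ^ (q ^ i) \<noteq> 0" for i using assms by (auto simp: pts_def)
  have "trace n (x + \<alpha> / x) = (\<Sum>i<n. x ^ (q ^ i)) + \<alpha> * (\<Sum>i<n. 1 / x ^ (q ^ i))"
    by (simp add: trace_def frob_add power_divide frob_rational[OF \<alpha>_rational] sum.distrib sum_distrib_left)
  then show ?thesis
    unfolding weight_def charpoly_def times_divide_eq_right[symmetric]
    using x by (simp only: coeffs_prod_linear(2,3) not_False_eq_True) simp
qed

section \<open>Frobenius orbits and divisibility by characteristic polynomials\<close>

lemma pts_dvd_iff:
  assumes x: "x \<noteq> 0" and d: "d > 0" "x ^ (q ^ d) = x" and min: "\<And>i. 0 < i \<Longrightarrow> i < d \<Longrightarrow> x ^ (q ^ i) \<noteq> x"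
  shows "x \<in> pts k \<longleftrightarrow> d dvd k"
proof -
  have mult: "x ^ (q ^ (j * d)) = x" for j
  proof (induction j)
    case (Suc j)
    have "x ^ (q ^ (Suc j * d)) = (x ^ (q ^ d)) ^ (q ^ (j * d))" by (simp add: frob_frob)
    then show ?case using Suc d by simp
  qed auto
  have "x ^ (q ^ k) = (x ^ (q ^ (k div d * d))) ^ (q ^ (k mod d))" by (simp add: frob_frob)
  then have "x ^ (q ^ k) = x ^ (q ^ (k mod d))" by (simp only: mult)
  then show ?thesis
    using min[of "k mod d"] x d by (cases "k mod d = 0") (auto simp: pts_def dvd_eq_mod_eq_0)
qed

lemma charpoly_mult_period:
  assumes "x ^ (q ^ d) = x"
  shows "charpoly (j * d) x = charpoly d x ^ j"
proof -
  have fx: "x ^ (q ^ (d + i)) = x ^ (q ^ i)" for i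
    using assms by (simp flip: frob_frob)
  have "charpoly (d + n) x = charpoly d x * charpoly n x" for n
    by (induction n) (simp_all add: charpoly_def fx mult_ac del: mult_pCons_left mult_pCons_right)
  then show ?thesis by (induction j) (simp_all add: charpoly_def)
qed

lemma inj_frob_orbit:
  fixes x :: 'k
  assumes min: "\<And>i. 0 < i \<Longrightarrow> i < d \<Longrightarrow> x ^ (q ^ i) \<noteq> x"
  shows "inj_on (\<lambda>i. x ^ (q ^ i)) {..<d}"
proof -
  have *: False if "i < j" "j < d" "x ^ (q ^ i) = x ^ (q ^ j)" for i j
  proof -
    have "(x ^ (q ^ (j - i))) ^ (q ^ i) = x ^ (q ^ j)" using that(1) by (simp add: frob_frob)
    then have "(x ^ (q ^ (j - i))) ^ (q ^ i) = x ^ (q ^ i)" using that(3) by simp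
    then have "x ^ (q ^ (j - i)) = x" by (rule frob_inj)
    with min[of "j - i"] that show False by (simp add: less_imp_diff_less)
  qed
  show ?thesis
    by (rule inj_onI) (metis * lessThan_iff linorder_neqE_nat)
qed

text \<open>The d conjugates are distinct by the minimality condition, and all are roots of g
  because g commutes with Frobenius. For d the exact period, \<open>charpoly d x\<close> is thus the
  minimal polynomial of x.\<close>

lemma charpoly_dvd:
  assumes min: "\<And>i. 0 < i \<Longrightarrow> i < d \<Longrightarrow> x ^ (q ^ i) \<noteq> x"
    and g: "rational_poly g" "poly g x = 0"
  shows "charpoly d x dvd g"
proof -
  have "charpoly d x = (\<Prod>a\<in>(\<lambda>i. x ^ (q ^ i)) ` {..<d}. [:-a, 1:])"
    unfolding charpoly_def by (subst prod.reindex[OF inj_frob_orbit[OF min]]) auto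
  also have "\<dots> dvd g"
    using qn_pos by (intro prod_linear_dvd) (auto simp: poly_frob_power[OF g(1)] g(2) power_0_left)
  finally show ?thesis .
qed

lemma poly_charpoly: "k > 0 \<Longrightarrow> poly (charpoly k x) x = 0"
  unfolding charpoly_def poly_prod by (auto intro!: prod_zero bexI[of _ 0])

text \<open>The orbit of a root consists of roots and is finite; injectivity of Frobenius turns a
  repetition into a return to the start.\<close>

lemma root_periodic:
  assumes "rational_poly h" "h \<noteq> 0" "poly h x = 0"
  shows "\<exists>d>0. x ^ (q ^ d) = x"
proof -
  have "finite {x. poly h x = 0}" using assms by (intro poly_roots_finite) auto
  moreover have "range (\<lambda>i. x ^ (q ^ i)) \<subseteq> {x. poly h x = 0}"
    using assms q_gt_1 by (auto simp: poly_frob_power)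
  ultimately have "\<not> inj (\<lambda>i. x ^ (q ^ i))"
    using finite_subset infinite_UNIV_nat by (metis finite_imageD)
  then obtain i j where "i \<noteq> j" "x ^ (q ^ i) = x ^ (q ^ j)" by (auto simp: inj_on_def)
  then obtain i j where ij: "i < j" "x ^ (q ^ i) = x ^ (q ^ j)"
    by (metis linorder_neqE_nat)
  have "(x ^ (q ^ (j - i))) ^ (q ^ i) = x ^ (q ^ i)" using ij by (simp add: frob_frob)
  then have "x ^ (q ^ (j - i)) = x" by (rule frob_inj)
  with ij show ?thesis by (intro exI[of _ "j - i"]) auto
qed

text \<open>Let d be the exact period of x and P its minimal polynomial. The admissible k are
  multiples jd, with characteristic polynomial P^j. As x is a simple root of P, P^j divides h
  exactly for j up to the order of h at x.\<close>

lemma card_charpoly_dvd_root: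
  assumes h: "h \<in> monics n" and x: "poly h x = 0"
  shows "card {k \<in> {1..n}. x \<in> pts k \<and> charpoly k x dvd h} = order x h"
proof -
  have h': "rational_poly h" "h \<noteq> 0" "degree h = n" "coeff h 0 \<noteq> 0" using h by (auto simp: monics_def)
  have x0: "x \<noteq> 0" using x h' by (auto simp: poly_0_coeff_0)
  define d where "d = (LEAST d. d > 0 \<and> x ^ (q ^ d) = x)"
  have d: "d > 0" "x ^ (q ^ d) = x"
    using LeastI_ex[OF root_periodic[OF h'(1,2) x, unfolded bex_simps]] by (auto simp: d_def)
  have min: "x ^ (q ^ i) \<noteq> x" if "0 < i" "i < d" for i
    using not_less_Least[of i "\<lambda>d. d > 0 \<and> x ^ (q ^ d) = x"] that by (auto simp: d_def)
  have pts: "x \<in> pts k \<longleftrightarrow> d dvd k" for k by (rule pts_dvd_iff[OF x0 d min])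
  define P where "P = charpoly d x"
  have P: "P \<in> monics d" unfolding P_def using pts by (intro charpoly_monics) auto
  then have P0: "P \<noteq> 0" by (auto simp: monics_def)
  have Pj: "P ^ j \<in> monics (j * d)" for j
    unfolding P_def charpoly_mult_period[OF d(2), symmetric] using pts by (intro charpoly_monics) auto
  have ordP: "order x P = 1"
  proof -
    obtain d' where d': "d = Suc d'" using d by (cases d) auto
    have P_eq: "P = [:- x, 1:] * (\<Prod>i<d'. [:- (x ^ (q ^ Suc i)), 1:])"
      unfolding P_def charpoly_def d' prod.lessThan_Suc_shift by simp
    have "poly (\<Prod>i<d'. [:- (x ^ (q ^ Suc i)), 1:]) x \<noteq> 0"
      unfolding poly_prod prod_zero_iff[OF finite_lessThan] using min d' by fastforce
    then have "order x (\<Prod>i<d'. [:- (x ^ (q ^ Suc i)), 1:]) = 0" by (rule order_0I)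
    moreover have "order x [:- x, 1:] = 1" using order_power_n_n[of x 1] by simp
    ultimately show ?thesis using P0 unfolding P_eq by (subst order_mult) auto
  qed
  have ordPj: "order x (P ^ j) = j" for j
    by (induction j) (auto simp: order_mult P0 ordP)
  have Pdvd: "P ^ j dvd h" if "j \<le> order x h" for j
    using that
  proof (induction j)
    case (Suc j)
    then obtain g where g: "h = P ^ j * g" by auto
    then have gm: "g \<in> monics (n - j * d)" using monics_cancel[of "P ^ j" g n] h Pj by auto
    then have g0: "rational_poly g" "g \<noteq> 0" by (auto simp: monics_def)
    have "order x h = j + order x g" using g h'(2) by (simp add: order_mult ordPj)
    with Suc.prems have "order x g > 0" by simp
    then have "poly g x = 0" using g0 by (simp add: order_gt_0_iff)
    then have "P dvd g" unfolding P_def by (intro charpoly_dvd min g0)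
    then show ?case unfolding g by (auto simp: mult_ac)
  qed auto
  have "{k \<in> {1..n}. x \<in> pts k \<and> charpoly k x dvd h} = (\<lambda>j. j * d) ` {1..order x h}"
  proof (intro equalityI subsetI)
    fix k assume "k \<in> {k \<in> {1..n}. x \<in> pts k \<and> charpoly k x dvd h}"
    then have k: "k \<ge> 1" "d dvd k" "charpoly k x dvd h" using pts by auto
    then obtain j where j: "k = j * d" by (metis dvd_def mult.commute)
    have "P ^ j dvd h" using k j by (simp add: P_def charpoly_mult_period[OF d(2)])
    then have "j \<le> order x h" using h'(2) ordPj[of j] by (metis dvd_imp_order_le)
    with j k show "k \<in> (\<lambda>j. j * d) ` {1..order x h}" by (intro image_eqI[of _ _ j]) (auto simp: Suc_le_eq intro!: Nat.gr0I)
  next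
    fix k assume "k \<in> (\<lambda>j. j * d) ` {1..order x h}"
    then obtain j where "k = j * d" "j \<in> {1..order x h}" by blast
    then have j: "k = j * d" "1 \<le> j" "j \<le> order x h" by auto
    have "P ^ j dvd h" using j by (intro Pdvd)
    then obtain g where "h = P ^ j * g" by auto
    then have "j * d \<le> n" using monics_cancel[of "P ^ j" g n "j * d"] h Pj by auto
    with j d pts \<open>P ^ j dvd h\<close> show "k \<in> {k \<in> {1..n}. x \<in> pts k \<and> charpoly k x dvd h}"
      by (auto simp: P_def charpoly_mult_period[OF d(2)])
  qed
  also have "card \<dots> = order x h"
    using d by (subst card_image) (auto simp: inj_on_def)
  finally show ?thesis .
qed

text \<open>Grouped by x, the pairs number the order of h at each of its roots, and these orders add
  up to the degree.\<close>

lemma card_charpoly_dvd: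
  assumes h: "h \<in> monics n"
  shows "card {(k, x). k \<in> {1..n} \<and> x \<in> pts k \<and> charpoly k x dvd h} = n"
proof -
  have h': "h \<noteq> 0" "degree h = n" using h by (auto simp: monics_def)
  have fin: "finite {x. poly h x = 0}" using h' by (intro poly_roots_finite)
  have root: "poly h x = 0" if "k \<in> {1..n}" "charpoly k x dvd h" for k x
    using that poly_charpoly[of k x] by (auto elim!: dvdE)
  have "{(k, x). k \<in> {1..n} \<and> x \<in> pts k \<and> charpoly k x dvd h} =
      (\<lambda>(x, k). (k, x)) ` (SIGMA x:{x. poly h x = 0}. {k \<in> {1..n}. x \<in> pts k \<and> charpoly k x dvd h})"
    using root by force
  also have "card \<dots> = (\<Sum>x\<in>{x. poly h x = 0}. order x h)"
    using fin card_charpoly_dvd_root[OF h]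
    by (subst card_image, force simp: inj_on_def, subst card_SigmaI) (auto intro!: sum.cong)
  also have "\<dots> = n" using sum_order_eq_degree[OF h'(1)] h' by simp
  finally show ?thesis .
qed

lemma finite_monics: "finite (monics n)"
proof (rule finite_imageD)
  show "inj_on coeffs (monics n)" by (auto simp: inj_on_def coeffs_eq_iff)
  have "coeffs ` monics n \<subseteq> {xs. set xs \<subseteq> {x. x ^ q = x} \<and> length xs = n + 1}"
  proof safe
    fix h x assume "h \<in> monics n"
    then have h: "\<And>i. coeff h i ^ q = coeff h i" "degree h = n" "h \<noteq> 0"
      by (auto simp: monics_def rational_poly_iff)
    then show "length (coeffs h) = n + 1" by (simp add: length_coeffs)
    assume "x \<in> set (coeffs h)"
    then show "x ^ q = x" using h by (auto simp: coeffs_def)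
  qed
  then show "finite (coeffs ` monics n)"
    by (rule finite_subset) (intro finite_lists_length_eq finite_rational)
qed

text \<open>The identity $T L' = L \cdot \sum_k S_k T^k$ read off coefficientwise, with $n$ on the left
  counted by \<open>card_charpoly_dvd\<close> instead of an Euler product.\<close>

lemma newton_identity:
  "of_nat n * lcoeff n = (\<Sum>k=1..n. psum k * lcoeff (n - k))"
proof -
  \<comment> \<open>Division by the characteristic polynomial is a bijection onto
    \<open>monics (n - k)\<close>, and multiplicativity of the weight pulls out a constant
    factor.\<close>
  have inner: "(\<Sum>h | h \<in> monics n \<and> charpoly k x dvd h. weight h) = weight (charpoly k x) * lcoeff (n - k)"
    if k: "k \<in> {1..n}" and x: "x \<in> pts k" for k x
  proof -
    have cm: "charpoly k x \<in> monics k" by (rule charpoly_monics[OF x])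
    then have c0: "charpoly k x \<noteq> 0" by (auto simp: monics_def)
    have "(\<Sum>h | h \<in> monics n \<and> charpoly k x dvd h. weight h) =
        (\<Sum>g\<in>monics (n - k). weight (charpoly k x * g))"
    proof (rule sum.reindex_bij_witness[of _ "\<lambda>g. charpoly k x * g" "\<lambda>h. h div charpoly k x"])
      fix h assume "h \<in> {h \<in> monics n. charpoly k x dvd h}"
      then show "h div charpoly k x \<in> monics (n - k)"
        using monics_cancel[OF _ cm, of "h div charpoly k x" n] by (simp)
    next
      fix g assume "g \<in> monics (n - k)"
      then show "charpoly k x * g \<in> {h \<in> monics n. charpoly k x dvd h}"
        using monics_mult[OF cm, of g "n - k"] k by simp
    qed (use c0 in auto)
    also have "\<dots> = weight (charpoly k x) * lcoeff (n - k)"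
      by (simp add: lcoeff_def sum_distrib_left weight_mult[OF cm])
    finally show ?thesis .
  qed
  define T where "T = (SIGMA k:{1..n}. pts k)"
  have T: "finite T" unfolding T_def by (intro finite_SigmaI finite_pts) auto
  have "of_nat n * lcoeff n = (\<Sum>h\<in>monics n. weight h * of_nat n)"
    by (simp add: lcoeff_def sum_distrib_left mult.commute)
  also have "\<dots> = (\<Sum>h\<in>monics n. \<Sum>t\<in>{t\<in>T. charpoly (fst t) (snd t) dvd h}. weight h)"
  proof (intro sum.cong refl)
    fix h assume h: "h \<in> monics n"
    have "{t\<in>T. charpoly (fst t) (snd t) dvd h} = {(k, x). k \<in> {1..n} \<and> x \<in> pts k \<and> charpoly k x dvd h}"
      by (auto simp: T_def)
    then have "card {t\<in>T. charpoly (fst t) (snd t) dvd h} = n" using card_charpoly_dvd[OF h] by simp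
    then show "weight h * of_nat n = (\<Sum>t\<in>{t\<in>T. charpoly (fst t) (snd t) dvd h}. weight h)" by simp
  qed
  also have "\<dots> = (\<Sum>t\<in>T. \<Sum>h | h \<in> monics n \<and> charpoly (fst t) (snd t) dvd h. weight h)"
    by (rule sum.swap_restrict[OF finite_monics T])
  also have "\<dots> = (\<Sum>t\<in>T. \<chi> (trace (fst t) (snd t + \<alpha> / snd t)) * lcoeff (n - fst t))"
    by (intro sum.cong refl) (auto simp: T_def inner weight_charpoly)
  also have "\<dots> = (\<Sum>k\<in>{1..n}. \<Sum>x\<in>pts k. \<chi> (trace k (x + \<alpha> / x)) * lcoeff (n - k))"
    unfolding T_def by (subst sum.Sigma) (auto simp: finite_pts case_prod_unfold)
  also have "\<dots> = (\<Sum>k=1..n. psum k * lcoeff (n - k))"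
    by (simp add: psum_def sum_distrib_right)
  finally show ?thesis .
qed

section \<open>Values of the coefficients of the L-function\<close>

lemma character_sum:
  assumes c: "c ^ q = c"
  shows "(\<Sum>a | a ^ q = a. \<chi> (a * c)) = (if c = 0 then of_nat q else 0)"
proof (cases "c = 0")
  case True
  then show ?thesis using card_fixed[of 1] by (simp add: \<chi>_0)
next
  case False
  obtain b where b: "b ^ q = b" "\<chi> b \<noteq> 1" using \<chi>_nontrivial by auto
  \<comment> \<open>Translating a by b / c multiplies the sum by \<open>\<chi> b\<close>, which is
    not 1.\<close>
  have "(\<Sum>a | a ^ q = a. \<chi> (a * c)) = (\<Sum>a | a ^ q = a. \<chi> ((a + b / c) * c))"
    by (rule sum.reindex_bij_witness[of _ "\<lambda>a. a + b / c" "\<lambda>a. a - b / c"])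
       (use b c in \<open>auto intro!: rational_intros\<close>)
  also have "\<dots> = (\<Sum>a | a ^ q = a. \<chi> b * \<chi> (a * c))"
    using False b c by (intro sum.cong refl) (auto simp: distrib_right \<chi>_add rational_mult)
  finally have "(1 - \<chi> b) * (\<Sum>a | a ^ q = a. \<chi> (a * c)) = 0"
    by (simp add: sum_distrib_left[symmetric] algebra_simps)
  with b False show ?thesis by simp
qed

lemma lcoeff_0: "lcoeff 0 = 1"
proof -
  have "monics 0 = {1}"
  proof (intro equalityI subsetI)
    fix h assume "h \<in> monics 0"
    then have "degree h = 0" "coeff h 0 = 1" by (auto simp: monics_def)
    then show "h \<in> {1}" by (auto elim!: degree_eq_zeroE)
  qed (auto simp: monics_def rational_poly_def)
  then show ?thesis by (simp add: lcoeff_def weight_def \<chi>_0)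
qed

lemma lcoeff_1: "lcoeff 1 = psum 1"
  using newton_identity[of 1] by (simp add: lcoeff_0)

text \<open>For X^2 + aX + b the weight is \<open>\<chi> (a * (- 1 - \<alpha> / b))\<close>; by
  orthogonality in a only b = - \<alpha> survives, and it contributes q.\<close>

lemma lcoeff_2: "lcoeff 2 = of_nat q"
proof -
  define F where "F = {a :: 'k. a ^ q = a}"
  have "lcoeff 2 = (\<Sum>(b, a)\<in>(F - {0}) \<times> F. \<chi> (a * (- 1 - \<alpha> / b)))"
    unfolding lcoeff_def
  proof (rule sum.reindex_bij_witness[of _ "\<lambda>(b, a). [:b, a, 1:]" "\<lambda>h. (coeff h 0, coeff h 1)"])
    fix h assume h: "h \<in> monics 2"
    then have h': "degree h = 2" "coeff h 2 = 1" "rational_poly h" "coeff h 0 \<noteq> 0"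
      by (auto simp: monics_def)
    have "h = [:coeff h 0, coeff h 1, 1:]"
    proof (rule poly_eqI)
      fix n show "coeff h n = coeff [:coeff h 0, coeff h 1, 1:] n"
        using h' coeff_eq_0[of h n] by (auto simp: coeff_pCons numeral_2_eq_2 split: nat.split)
    qed
    then show "(case (coeff h 0, coeff h 1) of (b, a) \<Rightarrow> [:b, a, 1:]) = h" by simp
    show "(coeff h 0, coeff h 1) \<in> (F - {0}) \<times> F"
      using h' by (auto simp: F_def rational_poly_iff)
    have "coeff (reflect_poly h) 1 = coeff h 1" using h' by (simp add: coeff_reflect_poly)
    then show "(case (coeff h 0, coeff h 1) of (b, a) \<Rightarrow> \<chi> (a * (- 1 - \<alpha> / b))) = weight h"
      by (simp add: weight_def algebra_simps)
  next
    fix t assume "t \<in> (F - {0}) \<times> F"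
    then show "(case t of (b, a) \<Rightarrow> [:b, a, 1:]) \<in> monics 2"
      using q_gt_1 by (auto simp: monics_def rational_poly_def F_def map_poly_pCons)
  qed auto
  also have "\<dots> = (\<Sum>b\<in>F - {0}. \<Sum>a\<in>F. \<chi> (a * (- 1 - \<alpha> / b)))"
    by (subst sum.cartesian_product) simp
  also have "\<dots> = (\<Sum>b\<in>F - {0}. if b = - \<alpha> then of_nat q else 0)"
  proof (intro sum.cong refl)
    fix b assume b: "b \<in> F - {0}"
    have "(- 1 - \<alpha> / b) ^ q = - 1 - \<alpha> / b"
      using b by (intro rational_intros) (auto simp: F_def)
    moreover have "- 1 - \<alpha> / b = 0 \<longleftrightarrow> b = - \<alpha>"
      using b by (auto simp: field_simps)
    ultimately show "(\<Sum>a\<in>F. \<chi> (a * (- 1 - \<alpha> / b))) = (if b = - \<alpha> then of_nat q else 0)"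
      unfolding F_def by (simp add: character_sum)
  qed
  also have "\<dots> = of_nat q"
    using finite_rational \<alpha>_nz rational_minus[OF \<alpha>_rational] by (simp add: F_def)
  finally show ?thesis .
qed

text \<open>From n = 3 on, the coefficient of X^(n - 1) is neither the constant nor the linear one.
  Shifting it permutes \<open>monics n\<close> and multiplies all weights by one value of
  \<open>\<chi>\<close>, chosen different from 1.\<close>

lemma lcoeff_eq_0:
  assumes "n \<ge> 3"
  shows "lcoeff n = 0"
proof -
  obtain b where b: "b ^ q = b" "\<chi> b \<noteq> 1" using \<chi>_nontrivial by auto
  have mem: "h + monom c (n - 1) \<in> monics n" if h: "h \<in> monics n" and c: "c ^ q = c" for h c
  proof -
    have h': "rational_poly h" "lead_coeff h = 1" "degree h = n" "coeff h 0 \<noteq> 0"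
      using h by (auto simp: monics_def)
    have "degree (monom c (n - 1)) < degree h"
      using h' assms by (intro le_less_trans[OF degree_monom_le]) auto
    then have "degree (h + monom c (n - 1)) = n" using h' by (subst degree_add_eq_left) auto
    then show ?thesis using h' assms c q_gt_1
      by (auto simp: monics_def rational_poly_iff rational_add)
  qed
  have weight: "weight (h + monom c (n - 1)) = \<chi> (- c) * weight h"
    if h: "h \<in> monics n" and c: "c ^ q = c" for h c
  proof -
    have h': "rational_poly h" "lead_coeff h = 1" "degree h = n" "coeff h 0 \<noteq> 0"
      using h by (auto simp: monics_def)
    have "degree (h + monom c (n - 1)) = n" using mem[OF h c] by (simp add: monics_def)
    moreover have "n - 1 \<noteq> 1" using assms by simp
    ultimately have "weight (h + monom c (n - 1)) = \<chi> (- c + (- coeff h (n - 1) - \<alpha> * coeff h 1 / coeff h 0))"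
      using assms by (simp add: weight_def coeff_reflect_poly algebra_simps)
    also have "\<dots> = \<chi> (- c) * \<chi> (- coeff h (n - 1) - \<alpha> * coeff h 1 / coeff h 0)"
      using h' c by (intro \<chi>_add rational_intros) (auto simp: rational_poly_iff)
    also have "\<chi> (- coeff h (n - 1) - \<alpha> * coeff h 1 / coeff h 0) = weight h"
      using h' assms by (simp add: weight_def coeff_reflect_poly)
    finally show ?thesis .
  qed
  have "lcoeff n = (\<Sum>h\<in>monics n. weight (h + monom (- b) (n - 1)))"
    unfolding lcoeff_def
    by (rule sum.reindex_bij_witness[of _ "\<lambda>h. h + monom (- b) (n - 1)" "\<lambda>h. h + monom b (n - 1)"])
       (use b mem in \<open>auto simp: add.assoc add_monom rational_minus\<close>)
  also have "\<dots> = \<chi> b * lcoeff n"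
    unfolding lcoeff_def sum_distrib_left
    using b by (intro sum.cong refl) (subst weight, auto intro: rational_minus)
  finally show ?thesis using b by (metis mult_cancel_right1)
qed

lemma psum_2: "psum 2 = 2 * of_nat q - psum 1 ^ 2"
proof -
  have "{1..2::nat} = {1, 2}" by auto
  then have "2 * of_nat q = psum 1 * psum 1 + psum 2"
    using newton_identity[of 2] by (simp add: lcoeff_0 lcoeff_1[unfolded One_nat_def] lcoeff_2)
  then show ?thesis by (simp add: power2_eq_square)
qed

lemma psum_recurrence: "psum (n + 3) = - psum 1 * psum (n + 2) - of_nat q * psum (n + 1)"
proof -
  have "0 = (\<Sum>k\<in>{1..n + 3}. psum k * lcoeff (n + 3 - k))"
    using newton_identity[of "n + 3"] by (simp add: lcoeff_eq_0)
  also have "\<dots> = (\<Sum>k\<in>{n + 1, n + 2, n + 3}. psum k * lcoeff (n + 3 - k))"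
    by (rule sum.mono_neutral_right) (auto intro!: lcoeff_eq_0)
  also have "\<dots> = psum (n + 1) * of_nat q + psum (n + 2) * psum 1 + psum (n + 3)"
    using lcoeff_1 by (simp add: lcoeff_2 lcoeff_0)
  finally show ?thesis by (simp add: algebra_simps eq_neg_iff_add_eq_0)
qed

subsection \<open>The Weil bound\<close>

lemma trace_diff: "trace n (x - y) = trace n x - trace n y"
  by (simp add: trace_def frob_diff sum_subtractf)

text \<open>The sum telescopes. Hence a solution y of y^q - y = w lies in the extension of degree n
  exactly when w has trace zero.\<close>

lemma trace_frob_minus_id: "trace n (y ^ q - y) = y ^ (q ^ n) - y"
proof (induction n)
  case (Suc n)
  have "(y ^ q - y) ^ (q ^ n) = y ^ (q ^ Suc n) - y ^ (q ^ n)"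
    by (simp add: frob_diff flip: power_mult)
  with Suc show ?case by (simp add: trace_def)
qed (simp add: trace_def)

lemma trace_rational:
  assumes "x ^ (q ^ n) = x"
  shows "trace n x ^ q = trace n x"
proof -
  have "trace n x ^ q - trace n x = trace n (x ^ q - x)"
    by (simp add: trace_diff) (simp add: trace_def frob_sum1 mult.commute flip: power_mult)
  also have "\<dots> = 0" using assms by (simp add: trace_frob_minus_id)
  finally show ?thesis by simp
qed

lemma card_quadratic_roots: "card {x :: 'k. x \<noteq> 0 \<and> x + \<alpha> / x = u} \<le> 2"
proof -
  define h where "h = [:\<alpha>, - u, 1:]"
  have h: "h \<noteq> 0" "degree h = 2" by (simp_all add: h_def)
  have "card {x :: 'k. x \<noteq> 0 \<and> x + \<alpha> / x = u} \<le> card {x. poly h x = 0}"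
    by (intro card_mono poly_roots_finite h) (auto simp: h_def field_simps)
  also have "\<dots> \<le> 2" using card_poly_roots_bound[OF h(1)] h(2) by simp
  finally show ?thesis .
qed

text \<open>The curve $y^q - y = x + \alpha/x - b$ is hyperelliptic over the $y$-line: solving for $x$
  has discriminant $(y^q - y + b)^2 - 4\alpha$, a polynomial with simple roots only.\<close>

lemma card_trace_fibre:
  assumes "odd q" and m: "6 * q \<le> q ^ m" "m > 0"
  shows "q * card {x \<in> pts (2 * m). trace (2 * m) (x + \<alpha> / x) = c} \<le> q ^ (2 * m) + 8 * q * q ^ m"
proof (cases "{x \<in> pts (2 * m). trace (2 * m) (x + \<alpha> / x) = c} = {}")
  case False
  define A where "A = {x \<in> pts (2 * m). trace (2 * m) (x + \<alpha> / x) = c}"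
  define r where "r = q ^ m"
  have rr: "r * r = q ^ (2 * m)" by (simp add: r_def mult_2 power_add)
  \<comment> \<open>A point of the fibre supplies b of trace c. Subtracting b leaves trace zero, so
    all q solutions of y^q - y = x + \<alpha> / x - b lie in the field of r^2 elements.\<close>
  obtain x0 where x0: "x0 \<in> A" using False by (auto simp: A_def)
  define b where "b = x0 + \<alpha> / x0"
  have tr_b: "trace (2 * m) b = c" using x0 by (simp add: A_def b_def)
  define u where "u = monom 1 (q ^ 1) - monom 1 1 + [:b:]"
  note u = frob_minus_id_poly[of 1 b, folded u_def, simplified power_one_right, OF zero_less_one]
  define h where "h = u ^ 2 - [:4 * \<alpha>:]"
  have two: "(2 :: 'k) \<noteq> 0"
  proof
    assume "(2 :: 'k) = 0"
    then have "of_nat 2 = (0 :: 'k)" by simp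
    then have "CHAR('k) dvd 2" by (simp only: of_nat_eq_0_iff_char_dvd)
    then have "CHAR('k) = 2" using prime_CHAR by (simp add: primes_dvd_imp_eq)
    with \<open>odd q\<close> e_pos show False by (simp add: q_def)
  qed
  have "(4 :: 'k) = 2 * 2" by simp
  with two have four: "(4 :: 'k) \<noteq> 0" by (metis mult_eq_0_iff)
  have deg_u2: "degree (u ^ 2) = 2 * q" using u by (simp add: degree_power_eq)
  then have deg_h: "degree h = 2 * q" using q_gt_1 unfolding h_def diff_conv_add_uminus
    by (subst degree_add_eq_left) auto
  then have h0: "h \<noteq> 0" using q_gt_1 by auto
  obtain \<rho> where \<rho>: "poly h \<rho> = 0" using alg_closed_imp_poly_has_root[of h] deg_h q_gt_1 by auto
  \<comment> \<open>As u has derivative -1, h has derivative -2u, while u^2 = 4\<alpha> at a root of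
    h; this is nonzero in odd characteristic.\<close>
  have "order \<rho> h = 1"
  proof (rule order_eq_1_if_pderiv[OF h0 \<rho>])
    have "poly u \<rho> ^ 2 = 4 * \<alpha>" using \<rho> by (simp add: h_def)
    then have "poly u \<rho> \<noteq> 0" using four \<alpha>_nz by auto
    moreover have "pderiv h = - (2 * u)"
      by (simp add: h_def pderiv_diff power2_eq_square pderiv_mult u(3) pderiv_pCons)
    ultimately show "poly (pderiv h) \<rho> \<noteq> 0" using two by simp
  qed
  \<comment> \<open>By Euler's criterion \<open>G\<close> consists of the y for which h(y) is a
    nonzero square in the field of r^2 elements; the at most 2q zeros of h are treated
    separately.\<close>
  define G where "G = {y. y ^ (r * r) = y \<and> poly h y ^ ((r * r - 1) div 2) = 1}"
  define Z where "Z = {y. poly h y = 0}"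
  have G: "2 * card G \<le> r * r + 4 * q * r"
    unfolding G_def
  proof (rule stepanov_bound[OF prime_CHAR])
    show "r = CHAR('k) ^ (e * m)" by (simp add: r_def qn_CHAR)
    show "odd (order \<rho> h)" by (simp add: \<open>order \<rho> h = 1\<close>)
  qed (use assms deg_h q_gt_1 in \<open>auto simp: r_def\<close>)
  have "r * r > 1" unfolding rr using q_gt_1 m by (intro one_less_power) auto
  have "finite G" unfolding G_def
    using finite_fixed[of "2 * m"] m by (intro finite_subset[OF _ finite_fixed[of "2 * m"]]) (auto simp: rr)
  have Z: "finite Z" "card Z \<le> 2 * q"
    using h0 poly_roots_finite[of h] card_poly_roots_bound[of h] by (auto simp: Z_def deg_h)
  define B where "B = (SIGMA x:A. {y. y ^ q - y = x + \<alpha> / x - b})"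
  have finA: "finite A" unfolding A_def using finite_pts[of "2 * m"] m by auto
  have cardfib: "card {y :: 'k. y ^ q - y = w} = q" for w using card_frob_minus_id[of 1 w] by simp
  have finfib: "finite {y :: 'k. y ^ q - y = w}" for w
    using cardfib[of w] q_gt_1 by (metis card.infinite not_less_zero)
  have "card B = q * card A"
    unfolding B_def using finA finfib cardfib by (subst card_SigmaI) (auto simp: mult.commute)
  have sub: "prod.swap ` B \<subseteq> (SIGMA y:G \<union> Z. {x. x \<noteq> 0 \<and> x + \<alpha> / x = poly u y})"
  proof
    fix t assume "t \<in> prod.swap ` B"
    then obtain x y where xy: "t = (y, x)" "(x, y) \<in> B" by auto
    then have x: "x \<noteq> 0" "x ^ (q ^ (2 * m)) = x" "trace (2 * m) (x + \<alpha> / x) = c"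
      and y: "y ^ q - y = x + \<alpha> / x - b"
      by (auto simp: B_def A_def pts_def)
    have uy: "x + \<alpha> / x = poly u y" using y by (simp add: u(4))
    have "y ^ (q ^ (2 * m)) - y = trace (2 * m) (x + \<alpha> / x) - trace (2 * m) b"
      by (simp only: trace_frob_minus_id[symmetric] y trace_diff)
    then have yr: "y ^ (r * r) = y" using x tr_b by (simp add: rr)
    \<comment> \<open>A rational square root of the discriminant: (x - \<alpha> / x)^2 = (x +
      \<alpha> / x)^2 - 4\<alpha>.\<close>
    define z where "z = x - \<alpha> / x"
    have z: "z ^ (r * r) = z"
      using x by (simp add: z_def rr frob_diff power_divide frob_rational[OF \<alpha>_rational])
    have hz: "poly h y = z ^ 2"
      using x by (simp add: h_def uy[symmetric] z_def power2_eq_square field_simps)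
    have "y \<in> G" if "y \<notin> Z"
    proof -
      have "z \<noteq> 0" using that by (auto simp: Z_def hz)
      have "z * z ^ (r * r - 1) = z * 1"
      proof -
        have "Suc (r * r - 1) = r * r" using \<open>r * r > 1\<close> by simp
        then show ?thesis using z by (metis power_Suc mult_1_right)
      qed
      then have "z ^ (r * r - 1) = 1" using \<open>z \<noteq> 0\<close> by simp
      moreover have "2 * ((r * r - 1) div 2) = r * r - 1" using \<open>odd q\<close> by (simp add: r_def)
      ultimately have "poly h y ^ ((r * r - 1) div 2) = 1" by (simp add: hz flip: power_mult)
      with yr show "y \<in> G" by (simp add: G_def)
    qed
    with uy x show "t \<in> (SIGMA y:G \<union> Z. {x. x \<noteq> 0 \<and> x + \<alpha> / x = poly u y})"
      by (auto simp: xy)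
  qed
  have finq: "finite {x. x \<noteq> 0 \<and> x + \<alpha> / x = v}" for v :: 'k
    by (rule finite_subset[OF _ poly_roots_finite[of "[:\<alpha>, - v, 1:]"]]) (auto simp: field_simps)
  have "card B = card (prod.swap ` B)" by (simp add: card_image)
  also have "\<dots> \<le> card (SIGMA y:G \<union> Z. {x. x \<noteq> 0 \<and> x + \<alpha> / x = poly u y})"
    using \<open>finite G\<close> Z finq by (intro card_mono sub finite_SigmaI) auto
  also have "\<dots> = (\<Sum>y\<in>G \<union> Z. card {x. x \<noteq> 0 \<and> x + \<alpha> / x = poly u y})"
    using \<open>finite G\<close> Z finq by (intro card_SigmaI) auto
  \<comment> \<open>At most two x belong to each y. This factor 2 is offset by the leading term
    r^2/2 in the bound for \<open>card G\<close>.\<close>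
  also have "\<dots> \<le> card (G \<union> Z) * 2"
    using sum_bounded_above[of "G \<union> Z" "\<lambda>y. card {x. x \<noteq> 0 \<and> x + \<alpha> / x = poly u y}" 2]
      card_quadratic_roots by simp
  also have "\<dots> \<le> 2 * card G + 2 * card Z" using card_Un_le[of G Z] by simp
  also have "\<dots> \<le> r * r + 4 * q * r + 4 * q" using G Z by simp
  finally have "card B \<le> r * r + 4 * q * r + 4 * q" .
  moreover have "4 * q \<le> 4 * q * r" using q_gt_1 by (simp add: r_def)
  ultimately have "card B \<le> r * r + 8 * q * r" by linarith
  then show ?thesis unfolding rr \<open>card B = q * card A\<close> by (simp add: A_def r_def)
next
  case True
  show ?thesis unfolding True by simp
qed

lemma \<chi>_of_nat_mult: "x ^ q = x \<Longrightarrow> \<chi> (of_nat k * x) = \<chi> x ^ k \<and> (of_nat k * x) ^ q = of_nat k * x"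
  using q_gt_1 by (induction k) (auto simp: \<chi>_0 distrib_right \<chi>_add rational_add)

lemma norm_\<chi>: "x ^ q = x \<Longrightarrow> norm (\<chi> x) = 1"
proof -
  assume "x ^ q = x"
  then have "\<chi> x ^ CHAR('k) = 1" using \<chi>_of_nat_mult[of x "CHAR('k)"] by (simp add: \<chi>_0)
  then have "norm (\<chi> x) ^ CHAR('k) = 1" by (metis norm_one norm_power)
  then show ?thesis
    using prime_gt_0_nat[OF prime_CHAR] by (intro power_eq_imp_eq_base[of "norm (\<chi> x)" "CHAR('k)" 1]) auto
qed

lemma cnj_\<chi>:
  assumes "x ^ q = x"
  shows "cnj (\<chi> x) = \<chi> (- x)"
proof -
  have "\<chi> x * \<chi> (- x) = 1" using assms \<chi>_add[of x "- x"] by (simp add: rational_minus \<chi>_0)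
  moreover have "\<chi> x * cnj (\<chi> x) = 1" using norm_\<chi>[OF assms] by (simp add: complex_norm_square[symmetric])
  moreover from this have "\<chi> x \<noteq> 0" by auto
  ultimately show ?thesis
    using mult_left_cancel[of "\<chi> x" "cnj (\<chi> x)" "\<chi> (- x)"] by auto
qed

text \<open>Since the values of \<open>\<chi>\<close> sum to 0, each count may be replaced by its
  difference from the upper bound \<open>K\<close>. These differences have constant sign, so their
  absolute values add up to qK minus the total count, where the main terms cancel.\<close>

lemma norm_psum_le:
  assumes "odd q" and m: "6 * q \<le> q ^ m" "m > 0"
  shows "norm (psum (2 * m)) \<le> 8 * q * real q ^ m + 1"
proof -
  define F where "F = {c :: 'k. c ^ q = c}"
  define N where "N = (\<lambda>c. card {x \<in> pts (2 * m). trace (2 * m) (x + \<alpha> / x) = c})"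
  define K where "K = real (q ^ (2 * m)) / q + 8 * real q ^ m"
  have finP: "finite (pts (2 * m))" using m by (intro finite_pts) auto
  have F: "finite F" "card F = q" using finite_rational card_fixed[of 1] by (auto simp: F_def)
  have tr: "(\<lambda>x. trace (2 * m) (x + \<alpha> / x)) ` pts (2 * m) \<subseteq> F"
    unfolding F_def by (auto simp: pts_def intro!: trace_rational simp: frob_add power_divide frob_rational[OF \<alpha>_rational])
  have qK: "real q * K = real (q ^ (2 * m) + 8 * q * q ^ m)"
    using q_gt_1 by (simp add: K_def distrib_left)
  have N_le: "real (N c) \<le> K" for c
  proof -
    have "real (q * N c) \<le> real (q ^ (2 * m) + 8 * q * q ^ m)"
      unfolding N_def of_nat_le_iff by (rule card_trace_fibre[OF assms])
    then have "real q * real (N c) \<le> real q * K" unfolding qK of_nat_mult .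
    then show ?thesis using q_gt_1 by simp
  qed
  have "insert 0 (pts (2 * m)) = {x. x ^ (q ^ (2 * m)) = x}" using qn_pos[of "2 * m"] by (auto simp: pts_def power_0_left)
  then have "card (insert 0 (pts (2 * m))) = q ^ (2 * m)" using m by (simp only: card_fixed)
  moreover have "0 \<notin> pts (2 * m)" by (simp add: pts_def)
  ultimately have "Suc (card (pts (2 * m))) = q ^ (2 * m)" using finP by simp
  moreover have "card (pts (2 * m)) = (\<Sum>c\<in>F. N c)"
    unfolding N_def using sum.group[OF finP F(1) tr, of "\<lambda>_. 1 :: nat"] by simp
  ultimately have "real (Suc (\<Sum>c\<in>F. N c)) = real (q ^ (2 * m))" by simp
  then have sumN: "(\<Sum>c\<in>F. real (N c)) = real q ^ (2 * m) - 1" by simp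
  have "psum (2 * m) = (\<Sum>c\<in>F. \<chi> c * of_nat (N c))"
    unfolding psum_def sum.group[OF finP F(1) tr, symmetric] N_def by (simp add: mult.commute)
  also have "\<dots> = (\<Sum>c\<in>F. \<chi> c * of_nat (N c)) - (\<Sum>c\<in>F. \<chi> c) * of_real K"
    using character_sum[of 1] by (simp add: F_def)
  also have "\<dots> = (\<Sum>c\<in>F. \<chi> c * of_real (real (N c) - K))"
    by (simp add: sum_distrib_right sum_subtractf[symmetric] right_diff_distrib)
  finally have "norm (psum (2 * m)) \<le> (\<Sum>c\<in>F. norm (\<chi> c * of_real (real (N c) - K)))"
    by (simp only: norm_sum)
  also have "\<dots> = (\<Sum>c\<in>F. K - real (N c))"
    using N_le norm_\<chi> by (intro sum.cong refl) (simp add: norm_mult F_def flip: of_real_diff)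
  also have "\<dots> = q * K - (real q ^ (2 * m) - 1)" by (simp add: sum_subtractf sumN F)
  also have "\<dots> = 8 * q * real q ^ m + 1" unfolding qK by simp
  finally show ?thesis .
qed

text \<open>Conjugation negates the argument of \<open>\<chi>\<close>, and x -> -x undoes this
  because x + \<alpha> / x is odd.\<close>

lemma psum_1_real: "cnj (psum 1) = psum 1"
proof -
  have "cnj (psum 1) = (\<Sum>x\<in>pts 1. \<chi> (- (x + \<alpha> / x)))"
    unfolding psum_def cnj_sum
  proof (intro sum.cong refl)
    fix x assume "x \<in> pts 1"
    then have "(x + \<alpha> / x) ^ q = x + \<alpha> / x" by (auto simp: pts_def intro!: rational_intros)
    then show "cnj (\<chi> (trace 1 (x + \<alpha> / x))) = \<chi> (- (x + \<alpha> / x))"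
      using cnj_\<chi>[of "x + \<alpha> / x"] by (simp add: trace_def)
  qed
  also have "\<dots> = psum 1"
    unfolding psum_def trace_def
    by (rule sum.reindex_bij_witness[of _ uminus uminus]) (auto simp: pts_def rational_minus)
  finally show ?thesis .
qed

text \<open>With S = -a the L-function is (1 - w1 T)(1 - w2 T). If |a| > 2 sqrt q, both numbers are
  real and their squares sum to a^2 - 2q > 2q, so the larger square t exceeds q. Then t^m outgrows
  the bound 8q q^m + 1 on the sum of degree 2m.\<close>

theorem weil_bound:
  assumes "odd q"
  shows "norm (psum 1) \<le> 2 * sqrt q"
proof (rule ccontr)
  define a where "a = - Re (psum 1)"
  have a: "psum 1 = of_real (- a)"
    using psum_1_real by (simp add: a_def complex_eq_iff)
  assume "\<not> norm (psum 1) \<le> 2 * sqrt q"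
  then have "2 * sqrt q < \<bar>a\<bar>" unfolding a norm_of_real by simp
  then have "(2 * sqrt q)\<^sup>2 < \<bar>a\<bar>\<^sup>2" by (intro power_strict_mono) auto
  then have a4: "4 * real q < a\<^sup>2" by (simp add: power_mult_distrib)
  define D where "D = sqrt (a\<^sup>2 - 4 * q)"
  have D2: "D\<^sup>2 = a\<^sup>2 - 4 * q" using a4 by (simp add: D_def)
  define w1 where "w1 = (a + D) / 2"
  define w2 where "w2 = (a - D) / 2"
  have sum: "w1 + w2 = a" by (simp add: w1_def w2_def field_simps)
  have "w1 * w2 = (a\<^sup>2 - D\<^sup>2) / 4" by (simp add: w1_def w2_def field_simps power2_eq_square)
  then have prod: "w1 * w2 = q" by (simp add: D2)
  have "w1\<^sup>2 + w2\<^sup>2 = (w1 + w2)\<^sup>2 - 2 * (w1 * w2)" by (simp add: power2_eq_square algebra_simps)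
  then have sq: "w1\<^sup>2 + w2\<^sup>2 = a\<^sup>2 - 2 * q" by (simp only: sum prod)
  define s where "s = (\<lambda>n. w1 ^ n + w2 ^ n)"
  have step: "s (n + 2) = a * s (n + 1) - q * s n" for n
  proof -
    have "s (n + 2) = (w1 + w2) * s (n + 1) - (w1 * w2) * s n" by (simp add: s_def algebra_simps)
    then show ?thesis by (simp only: sum prod)
  qed
  have psum: "psum (n + 1) = - of_real (s (n + 1)) \<and> psum (n + 2) = - of_real (s (n + 2))" for n
  proof (induction n)
    case 0
    have "psum 2 = - of_real (s 2)" unfolding psum_2 s_def sq a by (simp add: power2_eq_square)
    moreover have "psum 1 = - of_real (s 1)" unfolding a by (simp add: s_def sum)
    ultimately show ?case by (simp add: numeral_2_eq_2)
  next
    case (Suc n)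
    have "psum (n + 3) = - of_real (a * s (n + 2) - q * s (n + 1))"
      unfolding psum_recurrence a conjunct1[OF Suc] conjunct2[OF Suc] by simp
    also have "a * s (n + 2) - q * s (n + 1) = s (n + 3)"
      using step[of "n + 1"] by (simp add: numeral_3_eq_3)
    finally show ?case using Suc by (simp add: numeral_3_eq_3 numeral_2_eq_2)
  qed
  define t where "t = max (w1\<^sup>2) (w2\<^sup>2)"
  have "t > q" using sq a4 by (auto simp: t_def max_def)
  \<comment> \<open>The condition on m guarantees 6q \<le> q^m, since an odd q is at least
    3.\<close>
  have bound: "t ^ m \<le> 8 * q * real q ^ m + 1" if "m \<ge> 3" for m
  proof -
    have q3: "q \<ge> 3" using q_gt_1 \<open>odd q\<close> by (cases "q = 2") auto
    have "6 \<le> 3 * (3::nat)" by simp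
    also have "3 * 3 \<le> q * q" using q3 by (intro mult_mono) auto
    finally have "6 * q \<le> q ^ 3" by (simp add: power3_eq_cube)
    also have "\<dots> \<le> q ^ m" using that q_gt_1 by (intro power_increasing) auto
    finally have 6: "6 * q \<le> q ^ m" .
    define k where "k = 2 * m - 2"
    have k: "2 * m = k + 2" using that by (simp add: k_def)
    have "t ^ m \<le> (w1\<^sup>2) ^ m + (w2\<^sup>2) ^ m" by (auto simp: t_def max_def)
    also have "\<dots> = s (2 * m)" by (simp only: power_mult s_def)
    also have "\<dots> \<le> norm (psum (2 * m))"
      unfolding k conjunct2[OF psum] norm_minus_cancel norm_of_real by simp
    also have "\<dots> \<le> 8 * q * real q ^ m + 1" using \<open>odd q\<close> 6 that by (intro norm_psum_le) auto
    finally show ?thesis .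
  qed
  have q0: "real q > 0" using q_gt_1 by simp
  then have "1 < t / q" using \<open>t > q\<close> by simp
  then obtain m where m: "8 * q + 1 < (t / q) ^ m" using real_arch_pow by blast
  define B where "B = real q ^ (m + 3)"
  have "B \<ge> 1" unfolding B_def using q_gt_1 by (intro one_le_power) simp
  have "(t / q) ^ m \<le> (t / q) ^ (m + 3)" using \<open>1 < t / q\<close> by (intro power_increasing) auto
  also have "\<dots> = t ^ (m + 3) / B" by (simp only: power_divide B_def)
  also have "\<dots> \<le> (8 * q * B + 1) / B"
    unfolding B_def using q0 by (intro divide_right_mono bound) auto
  also have "\<dots> = 8 * q + 1 / B" using \<open>B \<ge> 1\<close> by (simp add: add_divide_distrib)
  also have "\<dots> \<le> 8 * q + 1" using \<open>B \<ge> 1\<close> by simp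
  finally show False using m by simp
qed

end

subsection \<open>Norms from cyclotomic fields\<close>

lemma power_mod_root_of_unity:
  fixes \<zeta> :: "'b::monoid_mult"
  assumes "\<zeta> ^ p = 1"
  shows "\<zeta> ^ n = \<zeta> ^ (n mod p)"
proof -
  have "\<zeta> ^ n = \<zeta> ^ (p * (n div p) + n mod p)" by simp
  also have "\<dots> = \<zeta> ^ (n mod p)" unfolding power_add power_mult assms by simp
  finally show ?thesis .
qed

lemma sum_powers_root_of_unity:
  fixes \<zeta> :: "'b::field"
  assumes "prime p" "\<zeta> ^ p = 1" "\<zeta> \<noteq> 1"
  shows "(\<Sum>b<p. \<zeta> ^ (j * b)) = (if p dvd j then of_nat p else 0)"
proof (cases "p dvd j")
  case True
  then have "\<zeta> ^ j = 1" using power_mod_root_of_unity[OF assms(2), of j] by (simp add: dvd_eq_mod_eq_0)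
  then show ?thesis using True by (simp add: power_mult)
next
  case False
  have "\<zeta> ^ j \<noteq> 1"
  proof
    assume j: "\<zeta> ^ j = 1"
    have "coprime j p" using False assms(1) by (metis coprime_commute prime_imp_coprime)
    then obtain x y where "j * x = p * y + 1"
      using coprime_bezout_strong[of j p] prime_gt_1_nat[OF assms(1)] by auto
    then have "\<zeta> ^ (j * x) = \<zeta> ^ (p * y + 1)" by simp
    then show False using j assms by (simp add: power_add power_mult)
  qed
  moreover have "(\<zeta> ^ j) ^ p = 1" using assms(2) by (metis mult.commute power_mult power_one)
  ultimately show ?thesis using False geometric_sum[of "\<zeta> ^ j" p] by (simp add: power_mult)
qed

text \<open>The product is the norm of \<open>G(\<zeta>)\<close>. With $N_b = \prod_a G(\zeta^{ab}) = \sum_i c_i \zeta^{ib}$ one has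
  $N_b = N_1$ for $b \neq 0$, so $\sum_b \zeta^{-b} N_b = N_0 - N_1$ is $p$ times the sum of the
  $c_i$ with $i \equiv 1$. Hence $N_1$ is an integer congruent to $N_0 = G(1)^{p-1}$ modulo $p$.\<close>

lemma norm_prod_conjugates_ge_1:
  fixes G :: "complex poly" and \<zeta> :: complex
  assumes p: "prime p" and \<zeta>: "\<zeta> ^ p = 1" "\<zeta> \<noteq> 1"
    and G: "\<And>i. coeff G i \<in> \<int>" and G1: "poly G 1 = of_int g" "\<not> int p dvd g"
  shows "1 \<le> norm (\<Prod>a\<in>{1..<p}. poly G (\<zeta> ^ a))"
proof -
  have p0: "p > 1" using p by (rule prime_gt_1_nat)
  define R where "R = (\<Prod>a\<in>{1..<p}. pcompose G (monom 1 a))"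
  have "coeff (\<Prod>a\<in>A. pcompose G (monom 1 a)) i \<in> \<int>" for A :: "nat set" and i
  proof (induction A arbitrary: i rule: infinite_finite_induct)
    case (insert a A)
    have "coeff (pcompose G (monom 1 a)) i \<in> \<int>" for i
      using G by (intro coeff_pcompose_semiring_closed) (auto simp: coeff_monom)
    then show ?case unfolding prod.insert[OF insert.hyps]
      by (intro coeff_mult_semiring_closed insert.IH) auto
  qed (auto simp: coeff_1)
  then have R: "coeff R i \<in> \<int>" for i by (simp add: R_def)
  define N where "N = (\<lambda>b. \<Prod>a\<in>{1..<p}. poly G (\<zeta> ^ (a * b)))"
  have N_R: "N b = poly R (\<zeta> ^ b)" for b
    by (simp add: N_def R_def poly_prod poly_pcompose poly_monom mult.commute flip: power_mult)
  have perm: "N b = N 1" if b: "b \<in> {1..<p}" for b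
  proof -
    have inj: "inj_on (\<lambda>a. a * b mod p) {1..<p}"
    proof (rule inj_onI)
      fix a a' assume a: "a \<in> {1..<p}" "a' \<in> {1..<p}" "a * b mod p = a' * b mod p"
      have "\<not> p dvd b" using b by (auto dest: dvd_imp_le)
      then have cop: "coprime (int p) (int b)" using p by (simp add: prime_imp_coprime)
      have "int (a * b) mod int p = int (a' * b) mod int p" using a(3) by (metis of_nat_mod)
      then have "int p dvd (int a - int a') * int b" by (simp add: mod_eq_dvd_iff left_diff_distrib)
      then have "int p dvd int a - int a'" using cop by (simp add: coprime_dvd_mult_left_iff)
      then show "a = a'" using a(1,2) zdvd_not_zless[of "\<bar>int a - int a'\<bar>" "int p"] by force
    qed
    have sub: "(\<lambda>a. a * b mod p) ` {1..<p} \<subseteq> {1..<p}"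
    proof safe
      fix a assume a: "a \<in> {1..<p}"
      have "\<not> p dvd a * b" using a b p by (auto simp: prime_dvd_mult_iff dest: dvd_imp_le)
      then show "a * b mod p \<in> {1..<p}" using p0 by (simp add: dvd_eq_mod_eq_0 Suc_le_eq)
    qed
    have "(\<lambda>a. a * b mod p) ` {1..<p} = {1..<p}" by (rule endo_inj_surj[OF _ sub inj]) simp
    then have "N 1 = (\<Prod>a\<in>(\<lambda>a. a * b mod p) ` {1..<p}. poly G (\<zeta> ^ a))" by (simp add: N_def)
    also have "\<dots> = (\<Prod>a\<in>{1..<p}. poly G (\<zeta> ^ (a * b mod p)))"
      by (subst prod.reindex[OF inj]) (simp add: o_def)
    also have "\<dots> = N b"
      unfolding N_def power_mod_root_of_unity[OF \<zeta>(1), symmetric] ..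
    finally show ?thesis by simp
  qed
  have set_p: "{..<p} = insert 0 {1..<p}" using p0 by auto
  \<comment> \<open>The exponent (p - 1)b stands for -b, which keeps all exponents natural
    numbers.\<close>
  have "(\<Sum>b<p. \<zeta> ^ ((p - 1) * b)) = 0"
    using sum_powers_root_of_unity[OF p \<zeta>, of "p - 1"] p0 by (auto dest!: dvd_imp_le)
  then have sum0: "(\<Sum>b\<in>{1..<p}. \<zeta> ^ ((p - 1) * b)) = - 1"
    unfolding set_p by (simp add: eq_neg_iff_add_eq_0 add.commute)
  have "(\<Sum>b\<in>{1..<p}. \<zeta> ^ ((p - 1) * b) * N b) = (\<Sum>b\<in>{1..<p}. \<zeta> ^ ((p - 1) * b) * N 1)"
    by (intro sum.cong refl arg_cong2[of _ _ _ _ "(*)"] perm)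
  then have "(\<Sum>b<p. \<zeta> ^ ((p - 1) * b) * N b) = N 0 + (\<Sum>b\<in>{1..<p}. \<zeta> ^ ((p - 1) * b) * N 1)"
    unfolding set_p by (subst sum.insert) auto
  also have "\<dots> = N 0 - N 1" unfolding sum_distrib_right[symmetric] sum0 by simp
  finally have "N 0 - N 1 = (\<Sum>b<p. \<zeta> ^ ((p - 1) * b) * N b)" ..
  moreover have "\<zeta> ^ ((p - 1 + i) * b) = \<zeta> ^ ((p - 1) * b) * (\<zeta> ^ b) ^ i" for i b
    by (simp only: distrib_right power_add mult.commute[of i b] power_mult)
  then have "\<zeta> ^ ((p - 1) * b) * N b = (\<Sum>i\<le>degree R. coeff R i * \<zeta> ^ ((p - 1 + i) * b))" for b
    by (simp only: N_R poly_altdef sum_distrib_left mult.left_commute)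
  ultimately have "N 0 - N 1 = (\<Sum>b<p. \<Sum>i\<le>degree R. coeff R i * \<zeta> ^ ((p - 1 + i) * b))"
    by (simp only:)
  also have "\<dots> = (\<Sum>i\<le>degree R. coeff R i * (\<Sum>b<p. \<zeta> ^ ((p - 1 + i) * b)))"
    by (subst sum.swap) (simp add: sum_distrib_left)
  also have "\<dots> = (\<Sum>i\<le>degree R. coeff R i * (if p dvd p - 1 + i then of_nat p else 0))"
    by (simp only: sum_powers_root_of_unity[OF p \<zeta>])
  also have "\<dots> = of_nat p * (\<Sum>i\<le>degree R. coeff R i * (if p dvd p - 1 + i then 1 else 0))"
    by (simp add: sum_distrib_left mult_ac if_distrib cong: if_cong)
  finally have N01: "N 0 - N 1 = of_nat p * (\<Sum>i\<le>degree R. coeff R i * (if p dvd p - 1 + i then 1 else 0))" .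
  have "(\<Sum>i\<le>degree R. coeff R i * (if p dvd p - 1 + i then 1 else 0)) \<in> \<int>"
    using R by (intro Ints_sum Ints_mult) auto
  then obtain c where c: "(\<Sum>i\<le>degree R. coeff R i * (if p dvd p - 1 + i then 1 else 0)) = of_int c"
    by (elim Ints_cases)
  have "N 0 = of_int (g ^ (p - 1))" by (simp add: N_def G1)
  with N01 have N1: "N 1 = of_int (g ^ (p - 1) - int p * c)"
    unfolding c by (simp add: algebra_simps)
  have "g ^ (p - 1) - int p * c \<noteq> 0"
  proof
    assume "g ^ (p - 1) - int p * c = 0"
    then have "int p dvd g ^ (p - 1)" by simp
    with p G1(2) show False using prime_dvd_power[of "int p" g "p - 1"] by simp
  qed
  then have "1 \<le> norm (N 1)" unfolding N1 norm_of_int by linarith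
  then show ?thesis by (simp add: N_def)
qed

subsection \<open>Finite fields and the main estimate\<close>

text \<open>A subgroup of largest p-power order must be everything: the translates of
  \<open>H\<close> by the p multiples of an outside element x would form a subgroup p times as
  large. In \<open>sub\<close> negation is left out because - h = (p - 1) h.\<close>

lemma card_eq_CHAR_power:
  "\<exists>e>0. card (UNIV :: 'a::{field,finite} set) = CHAR('a) ^ e"
proof -
  define p where "p = CHAR('a)"
  have "p > 0" unfolding p_def by (rule finite_imp_CHAR_pos) simp
  then have p: "prime p" unfolding p_def by (rule prime_CHAR_semidom)
  define sub where "sub = (\<lambda>H :: 'a set. 0 \<in> H \<and> (\<forall>x\<in>H. \<forall>y\<in>H. x + y \<in> H))"
  define S where "S = {e. \<exists>H. sub H \<and> card H = p ^ e}"
  have "e < card (UNIV :: 'a set)" if e: "e \<in> S" for e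
  proof -
    obtain H :: "'a set" where "card H = p ^ e" using e by (auto simp: S_def)
    then have "p ^ e \<le> card (UNIV :: 'a set)" by (metis card_mono finite subset_UNIV)
    moreover have "e < p ^ e" using prime_gt_1_nat[OF p] by (simp add: power_gt_expt)
    ultimately show ?thesis by simp
  qed
  then have finS: "finite S" by (meson bounded_nat_set_is_finite)
  have "sub {0}" by (simp add: sub_def)
  then have "0 \<in> S" unfolding S_def by force
  define e where "e = Max S"
  have "e \<in> S" unfolding e_def using finS \<open>0 \<in> S\<close> by (intro Max_in) auto
  then obtain H where H: "sub H" "card H = p ^ e" by (auto simp: S_def)
  have H_mult: "of_nat n * h \<in> H" if "h \<in> H" for n h
    using that H(1) by (induction n) (auto simp: sub_def distrib_right)
  have H_minus: "- h \<in> H" if "h \<in> H" for h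
  proof -
    have "of_nat (p - 1) * h = - h"
      using \<open>p > 0\<close> by (simp add: p_def of_nat_diff Suc_le_eq)
    then show ?thesis using H_mult[OF that, of "p - 1"] by simp
  qed
  have "H = UNIV"
  proof (rule ccontr)
    assume "H \<noteq> UNIV"
    then obtain x where x: "x \<notin> H" by auto
    define f where "f = (\<lambda>(h, k). h + of_nat k * x)"
    have inj: "inj_on f (H \<times> {..<p})"
    proof -
      have *: False if "h \<in> H" "h' \<in> H" "k < k'" "k' < p" "h + of_nat k * x = h' + of_nat k' * x" for h h' k k'
      proof -
        have "of_nat (k' - k) * x = h + (- h')"
          using that by (simp add: of_nat_diff algebra_simps)
        moreover have "h + (- h') \<in> H" using H(1) that(1) H_minus[OF that(2)] unfolding sub_def by blast
        ultimately have d: "of_nat (k' - k) * x \<in> H" by (simp only:)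
        have "\<not> p dvd k' - k" using that by (auto dest: dvd_imp_le)
        then have "coprime (k' - k) p" using p by (metis coprime_commute prime_imp_coprime)
        \<comment> \<open>The Bezout coefficient u inverts k' - k modulo p, so a nonzero multiple of
          x in \<open>H\<close> would force x itself into \<open>H\<close>.\<close>
        then obtain u v where "(k' - k) * u = p * v + 1"
          using coprime_bezout_strong[of "k' - k" p] prime_gt_1_nat[OF p] by auto
        then have "of_nat ((k' - k) * u) = (of_nat (p * v + 1) :: 'a)" by (simp only:)
        then have "of_nat u * (of_nat (k' - k) * x) = x"
          by (simp add: p_def flip: mult.assoc) (simp add: mult.commute)
        with H_mult[OF d, of u] x show False by simp
      qed
      show ?thesis
      proof (rule inj_onI)
        fix s t assume st: "s \<in> H \<times> {..<p}" "t \<in> H \<times> {..<p}" "f s = f t"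
        then obtain h k h' k' where s: "s = (h, k)" "t = (h', k')" "h \<in> H" "h' \<in> H" "k < p" "k' < p"
          by auto
        then have eq: "h + of_nat k * x = h' + of_nat k' * x" using st(3) by (simp add: f_def)
        then have "k = k'" using *[of h h' k k'] *[of h' h k' k] s by (metis linorder_neqE_nat)
        with eq s show "s = t" by simp
      qed
    qed
    have "sub (f ` (H \<times> {..<p}))"
      unfolding sub_def
    proof (intro conjI ballI)
      show "0 \<in> f ` (H \<times> {..<p})"
        using H(1) \<open>p > 0\<close> by (intro image_eqI[of _ _ "(0, 0)"]) (auto simp: f_def sub_def)
      fix s t assume "s \<in> f ` (H \<times> {..<p})" "t \<in> f ` (H \<times> {..<p})"
      then obtain h k h' k' where st: "s = h + of_nat k * x" "t = h' + of_nat k' * x" "h \<in> H" "h' \<in> H"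
        by (auto simp: f_def)
      have "(of_nat (k + k') :: 'a) = of_nat ((k + k') div p * p + (k + k') mod p)" by simp
      also have "\<dots> = of_nat ((k + k') mod p)" unfolding of_nat_add of_nat_mult by (simp add: p_def)
      finally have red: "(of_nat (k + k') :: 'a) = of_nat ((k + k') mod p)" .
      have "s + t = (h + h') + of_nat (k + k') * x" using st by (simp add: algebra_simps)
      then have "s + t = (h + h') + of_nat ((k + k') mod p) * x" by (simp only: red)
      then show "s + t \<in> f ` (H \<times> {..<p})"
        using st H(1) \<open>p > 0\<close> by (intro image_eqI[of _ _ "(h + h', (k + k') mod p)"]) (auto simp: f_def sub_def)
    qed
    moreover have "card (f ` (H \<times> {..<p})) = p ^ Suc e"
      using card_image[OF inj] by (simp add: card_cartesian_product H(2))
    ultimately have "Suc e \<in> S" unfolding S_def by blast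
    then have "Suc e \<le> e" unfolding e_def using finS by (rule Max_ge[rotated])
    then show False by simp
  qed
  moreover have "card {0, 1 :: 'a} \<le> card (UNIV :: 'a set)" by (rule card_mono) auto
  ultimately show ?thesis using H(2) by (intro exI[of _ e]) (auto simp: p_def intro!: Nat.gr0I)
qed

lemma power_card_UNIV:
  fixes x :: "'a::{field,finite}"
  shows "x ^ card (UNIV :: 'a set) = x"
proof (cases "x = 0")
  case True
  then show ?thesis by (simp add: finite_UNIV_card_ge_0)
next
  case False
  have "bij_betw (\<lambda>y. x * y) (UNIV - {0}) (UNIV - {0})"
    by (rule bij_betw_byWitness[of _ "\<lambda>y. y / x"]) (use False in auto)
  then have "\<Prod>(UNIV - {0}) = (\<Prod>y\<in>UNIV - {0}. x * y)"
    by (rule prod.reindex_bij_betw[symmetric])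
  also have "\<dots> = x ^ card (UNIV - {0 :: 'a}) * \<Prod>(UNIV - {0})" by (simp add: prod.distrib)
  finally have "x ^ card (UNIV - {0 :: 'a}) = 1" by simp
  moreover have "card (UNIV :: 'a set) = Suc (card (UNIV - {0 :: 'a}))" by (subst card.remove[of _ 0]) auto
  ultimately show ?thesis by (simp only: power_Suc mult_1_right)
qed

text \<open>X^q - X has at most q roots, and the embedded field already supplies q of them. This
  matches the given field with the fixed field of the locale.\<close>

lemma fixed_points_alg_closure:
  "{x :: 'a::{field,finite} alg_closure. x ^ card (UNIV :: 'a set) = x} = range to_ac"
proof -
  define q where "q = card (UNIV :: 'a set)"
  have "card {0, 1 :: 'a} \<le> q" unfolding q_def by (rule card_mono) auto
  then have q: "q > 1" by simp
  define h :: "'a alg_closure poly" where "h = monom 1 q - monom 1 1"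
  have "coeff h q = 1" using q by (simp add: h_def)
  then have h0: "h \<noteq> 0" by auto
  have "degree h \<le> q" unfolding h_def using q by (intro degree_diff_le) (auto simp: degree_monom_eq)
  moreover have roots: "{x. poly h x = 0} = {x. x ^ q = x}" by (simp add: h_def poly_monom)
  ultimately have "card {x :: 'a alg_closure. x ^ q = x} \<le> q"
    using card_poly_roots_bound[OF h0] by simp
  moreover have "finite {x :: 'a alg_closure. x ^ q = x}" using poly_roots_finite[OF h0] roots by simp
  moreover have "range to_ac \<subseteq> {x :: 'a alg_closure. x ^ q = x}"
    using power_card_UNIV by (auto simp: q_def simp flip: to_ac_power)
  moreover have "card (range (to_ac :: 'a \<Rightarrow> _)) = q" by (simp add: card_image inj_to_ac q_def)
  ultimately have "range to_ac = {x :: 'a alg_closure. x ^ q = x}" by (intro card_seteq) auto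
  then show ?thesis by (simp add: q_def)
qed

section \<open>Kloosterman sums over the given field\<close>

lemma add_char_0: "add_char \<psi> \<Longrightarrow> \<psi> 0 = 1"
  unfolding add_char_def by (metis add.left_neutral mult_cancel_right1)

lemma kloosterman_weil:
  fixes \<psi> :: "'a::{field,finite} \<Rightarrow> complex"
  assumes "odd CHAR('a)" "nontrivial_add_char \<psi>" "\<alpha> \<noteq> 0"
  shows "kloosterman \<psi> \<alpha> \<in> \<real>" "norm (kloosterman \<psi> \<alpha>) \<le> 2 * sqrt (card (UNIV :: 'a set))"
proof -
  define q where "q = card (UNIV :: 'a set)"
  obtain e where e: "e > 0" "q = CHAR('a) ^ e" using card_eq_CHAR_power[where ?'a = 'a] by (auto simp: q_def)
  have "CHAR('a) > 0" by (rule finite_imp_CHAR_pos) simp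
  then have p: "prime CHAR('a)" by (rule prime_CHAR_semidom)
  have fixed: "x ^ q = x \<longleftrightarrow> x \<in> range to_ac" for x :: "'a alg_closure"
    using fixed_points_alg_closure[where ?'a = 'a] by (auto simp: q_def)
  have \<psi>: "\<psi> (x + y) = \<psi> x * \<psi> y" for x y using assms by (auto simp: nontrivial_add_char_def add_char_def)
  obtain x1 where x1: "\<psi> x1 \<noteq> 1" using assms by (auto simp: nontrivial_add_char_def)
  \<comment> \<open>The character is transported by \<open>of_ac\<close>, which inverts
    \<open>to_ac\<close> on the fixed field.\<close>
  interpret K: kloosterman_char q e "\<lambda>x. \<psi> (of_ac x)" "to_ac \<alpha>"
  proof
    show "\<psi> (of_ac (x + y)) = \<psi> (of_ac x) * \<psi> (of_ac y)" if "x ^ q = x" "y ^ q = y" for x y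
      using that by (auto simp: fixed \<psi> simp flip: to_ac_add)
    show "\<exists>x. x ^ q = x \<and> \<psi> (of_ac x) \<noteq> 1" using x1 by (intro exI[of _ "to_ac x1"]) (auto simp: fixed)
    show "\<psi> (of_ac 0) = 1" using assms by (simp add: nontrivial_add_char_def add_char_0)
    show "to_ac \<alpha> ^ q = to_ac \<alpha>" by (simp add: fixed)
  qed (use assms e p in auto)
  have "K.pts 1 = to_ac ` (UNIV - {0})" by (auto simp: K.pts_def fixed)
  then have psum: "K.psum 1 = - kloosterman \<psi> \<alpha>"
    unfolding K.psum_def
    by (simp add: sum.reindex inj_on_def K.trace_def kloosterman_def flip: to_ac_divide to_ac_add)
  have "odd q" using assms e by simp
  then show "norm (kloosterman \<psi> \<alpha>) \<le> 2 * sqrt (card (UNIV :: 'a set))"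
    using K.weil_bound psum by (simp add: q_def)
  show "kloosterman \<psi> \<alpha> \<in> \<real>" using K.psum_1_real psum by (simp add: Reals_cnj_iff)
qed

text \<open>The norm has p - 1 factors. The one at \<zeta> is kept, and each of the other p - 2 is
  at most 4q + (q - 1)^2 = (q + 1)^2.\<close>

lemma kloosterman_gap:
  fixes \<psi> :: "'a::{field,finite} \<Rightarrow> complex"
  assumes "nontrivial_add_char \<psi>" "kloosterman \<psi> \<alpha> \<in> \<real>"
  defines "q \<equiv> card (UNIV :: 'a set)" and "p \<equiv> CHAR('a)"
  shows "1 \<le> norm (of_nat (4 * q) - (kloosterman \<psi> \<alpha>)\<^sup>2) * real (q + 1) ^ (2 * (p - 2))"
proof -
  have "p > 0" unfolding p_def by (rule finite_imp_CHAR_pos) simp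
  then have p: "prime p" unfolding p_def by (rule prime_CHAR_semidom)
  then have p2: "p \<ge> 2" by (rule prime_ge_2_nat)
  have "q > 0" unfolding q_def by (simp add: finite_UNIV_card_ge_0)
  have \<psi>: "\<psi> (x + y) = \<psi> x * \<psi> y" for x y using assms by (auto simp: nontrivial_add_char_def add_char_def)
  have \<psi>0: "\<psi> 0 = 1" using assms by (simp add: nontrivial_add_char_def add_char_0)
  have "\<psi> (of_nat n * x) = \<psi> x ^ n" for n x by (induction n) (auto simp: \<psi> \<psi>0 distrib_right)
  from this[of p] have \<psi>p: "\<psi> x ^ p = 1" for x by (simp add: p_def \<psi>0)
  define \<zeta> where "\<zeta> = cis (2 * pi / p)"
  have \<zeta>p: "\<zeta> ^ p = 1" using p2 by (simp add: \<zeta>_def DeMoivre)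
  have "\<exists>k. \<psi> x = \<zeta> ^ k" for x
  proof -
    have "\<psi> x \<in> (\<lambda>k. cis (2 * pi * real k / real p)) ` {..<p}"
      using bij_betw_imp_surj_on[OF bij_betw_roots_unity[OF \<open>p > 0\<close>]] \<psi>p by auto
    then show ?thesis by (auto simp: \<zeta>_def DeMoivre mult_ac)
  qed
  then obtain t where t: "\<And>x. \<psi> x = \<zeta> ^ t x" by metis
  have "\<zeta> \<noteq> 1" using assms t by (auto simp: nontrivial_add_char_def)
  \<comment> \<open>An integral polynomial lifting the sum: its value at \<zeta> is the Kloosterman
    sum, at \<zeta>^a a conjugate, and at 1 the residue 1 - q.\<close>
  define g :: "complex poly" where "g = - (\<Sum>x\<in>UNIV - {0}. monom 1 (t (x + \<alpha> / x)))"
  define G where "G = [:of_nat (4 * q):] - g * g"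
  have g: "coeff g i \<in> \<int>" for i
    unfolding g_def coeff_minus coeff_sum by (intro Ints_minus Ints_sum) (auto simp: coeff_monom)
  have "coeff (g * g) i \<in> \<int>" for i by (intro coeff_mult_semiring_closed g) auto
  then have G: "coeff G i \<in> \<int>" for i
    unfolding G_def coeff_diff by (intro Ints_diff) (auto simp: coeff_pCons split: nat.split)
  have card: "card (UNIV - {0 :: 'a}) = q - 1" by (simp add: q_def card_Diff_singleton)
  define n where "n = int q - 1"
  have q1: "real (q - 1) = real q - 1" "of_nat (q - 1) = (of_nat q - 1 :: complex)"
    using \<open>q > 0\<close> by (simp_all add: of_nat_diff Suc_le_eq)
  have "poly g 1 = - of_int n" using \<open>q > 0\<close> by (simp add: g_def poly_sum poly_monom card n_def q1)
  then have G1: "poly G 1 = of_int (4 * int q - n * n)" by (simp add: G_def)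
  have "\<not> int p dvd 4 * int q - n * n"
  proof
    assume dvd: "int p dvd 4 * int q - n * n"
    obtain e where "e > 0" "q = p ^ e" using card_eq_CHAR_power[where ?'a = 'a] by (auto simp: q_def p_def)
    then have "int p dvd int q" by simp
    \<comment> \<open>Since 4q - (q - 1)^2 = 6q - q^2 - 1, it is congruent to -1 modulo p.\<close>
    then have "int p dvd 6 * int q - int q * int q" by (intro dvd_diff dvd_mult2 dvd_mult)
    then have "int p dvd (6 * int q - int q * int q) - (4 * int q - n * n)" using dvd by (rule dvd_diff)
    also have "(6 * int q - int q * int q) - (4 * int q - n * n) = 1" by (simp add: n_def algebra_simps)
    finally show False using p2 by simp
  qed
  then have ge1: "1 \<le> norm (\<Prod>a\<in>{1..<p}. poly G (\<zeta> ^ a))"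
    by (rule norm_prod_conjugates_ge_1[OF p \<zeta>p \<open>\<zeta> \<noteq> 1\<close> G G1])
  have le: "norm (poly G (\<zeta> ^ a)) \<le> real (q + 1) ^ 2" for a
  proof -
    have "norm (poly g (\<zeta> ^ a)) \<le> (\<Sum>x\<in>UNIV - {0 :: 'a}. 1)"
      unfolding g_def poly_minus norm_minus_cancel poly_sum poly_monom
      by (rule order.trans[OF norm_sum], intro sum_mono) (simp add: norm_power \<zeta>_def)
    then have 1: "norm (poly g (\<zeta> ^ a)) \<le> real q - 1" by (simp only: sum_constant card q1 mult_1_right)
    have "norm (poly G (\<zeta> ^ a)) \<le> 4 * q + norm (poly g (\<zeta> ^ a)) * norm (poly g (\<zeta> ^ a))"
      using norm_triangle_ineq4[of "of_nat (4 * q)" "poly g (\<zeta> ^ a) * poly g (\<zeta> ^ a)"]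
      unfolding norm_mult norm_of_nat by (simp add: G_def)
    also have "\<dots> \<le> 4 * q + (real q - 1) * (real q - 1)"
      using 1 \<open>q > 0\<close> by (intro add_left_mono mult_mono) auto
    also have "\<dots> = real (q + 1) ^ 2" by (simp add: power2_eq_square algebra_simps)
    finally show ?thesis .
  qed
  have "poly g \<zeta> = kloosterman \<psi> \<alpha>"
    by (simp add: g_def poly_sum poly_monom kloosterman_def t)
  then have G\<zeta>: "poly G \<zeta> = of_nat (4 * q) - (kloosterman \<psi> \<alpha>)\<^sup>2"
    by (simp add: G_def power2_eq_square)
  have "{1..<p} = insert 1 {2..<p}" using p2 by auto
  then have "norm (\<Prod>a\<in>{1..<p}. poly G (\<zeta> ^ a)) = norm (poly G \<zeta>) * (\<Prod>a\<in>{2..<p}. norm (poly G (\<zeta> ^ a)))"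
    by (simp add: norm_mult prod_norm)
  also have "\<dots> \<le> norm (poly G \<zeta>) * (\<Prod>a\<in>{2..<p}. real (q + 1) ^ 2)"
    by (intro mult_left_mono prod_mono) (use le in auto)
  also have "(\<Prod>a\<in>{2..<p}. real (q + 1) ^ 2) = real (q + 1) ^ (2 * (p - 2))" by (simp add: power_mult)
  finally show ?thesis using ge1 unfolding G\<zeta> by linarith
qed

theorem theorem4p1:
  fixes p :: nat and \<psi> :: "'a::{field,finite} \<Rightarrow> complex" and \<alpha> :: 'a
  assumes "prime p" and "p \<ge> 3" and "CHAR('a) = p"
    and "nontrivial_add_char \<psi>" and "\<alpha> \<noteq> 0"
  shows "\<bar>kl_angle \<psi> \<alpha>\<bar> > real (card (UNIV :: 'a set)) powr (- (2 * (real p - 1)))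
     \<and> \<bar>pi - kl_angle \<psi> \<alpha>\<bar> > real (card (UNIV :: 'a set)) powr (- (2 * (real p - 1)))"
proof -
  define q where "q = card (UNIV :: 'a set)"
  have "odd CHAR('a)" using assms by (simp add: prime_odd_nat)
  note weil = kloosterman_weil[OF this assms(4,5), folded q_def]
  obtain \<kappa> where \<kappa>: "kloosterman \<psi> \<alpha> = of_real \<kappa>" using weil(1) by (elim Reals_cases)
  obtain e where "e > 0" "q = p ^ e" using card_eq_CHAR_power[where ?'a = 'a] assms by (auto simp: q_def)
  then have "p \<le> q" using assms by (auto intro: self_le_power)
  then have q: "real q \<ge> 3" using assms by simp
  define y where "y = \<kappa> / (2 * sqrt q)"
  have "\<bar>y\<bar> \<le> 1" using weil(2) q by (simp add: \<kappa> y_def abs_mult)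
  then have y1: "-1 \<le> y" "y \<le> 1" by auto
  have "\<kappa>\<^sup>2 \<le> 4 * q" using weil(2) power_mono[of "\<bar>\<kappa>\<bar>" "2 * sqrt q" 2]
    by (simp add: \<kappa> power_mult_distrib)
  have "norm (of_nat (4 * q) - (kloosterman \<psi> \<alpha>)\<^sup>2) = norm (complex_of_real (4 * q - \<kappa>\<^sup>2))"
    by (simp add: \<kappa>)
  also have "\<dots> = 4 * q - \<kappa>\<^sup>2" using \<open>\<kappa>\<^sup>2 \<le> 4 * q\<close> unfolding norm_of_real by simp
  finally have gap: "1 \<le> (4 * q - \<kappa>\<^sup>2) * real (q + 1) ^ (2 * (p - 2))"
    using kloosterman_gap[OF assms(4) weil(1)] assms(3) by (simp add: q_def)
  define \<theta> where "\<theta> = kl_angle \<psi> \<alpha>"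
  have \<theta>: "\<theta> = arccos y" by (simp add: \<theta>_def kl_angle_def y_def \<kappa> q_def)
  have \<theta>b: "0 \<le> \<theta>" "\<theta> \<le> pi" "cos \<theta> = y"
    unfolding \<theta> using y1 by (auto simp: arccos_lbound arccos_ubound)
  have "(sin \<theta>)\<^sup>2 = 1 - y\<^sup>2" using \<theta>b(3) by (simp add: sin_squared_eq)
  also have "\<dots> = (4 * q - \<kappa>\<^sup>2) / (4 * q)" using q by (simp add: y_def power_divide power_mult_distrib field_simps)
  finally have sin2: "(sin \<theta>)\<^sup>2 * (4 * q) = 4 * q - \<kappa>\<^sup>2" using q by simp
  define Q where "Q = real q ^ (2 * (p - 1))"
  have Q0: "Q > 0" using q by (simp add: Q_def)
  \<comment> \<open>In Q^2 = q^(4(p - 2)) q^4 the first factor absorbs (q + 1)^(2(p - 2)) and the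
    second absorbs 4q.\<close>
  have big: "4 * q * real (q + 1) ^ (2 * (p - 2)) < Q\<^sup>2"
  proof -
    define k where "k = p - 2"
    have k: "p = k + 2" using assms by (simp add: k_def)
    have q2: "real (q + 1) \<le> real q ^ 2"
      using mult_left_mono[OF q, of "real q"] q unfolding power2_eq_square of_nat_add by linarith
    have "real (q + 1) ^ (2 * k) \<le> (real q ^ 2) ^ (2 * k)" using q2 by (intro power_mono) auto
    moreover have "4 * real q < real q ^ 4"
    proof -
      have "3 ^ 3 \<le> real q ^ 3" using q by (intro power_mono) auto
      then have "4 < real q ^ 3" by simp
      then have "4 * real q < real q ^ 3 * real q" using q by (intro mult_strict_right_mono) auto
      then show ?thesis by (simp add: eval_nat_numeral mult_ac)
    qed
    ultimately have "4 * real q * real (q + 1) ^ (2 * k) < real q ^ 4 * (real q ^ 2) ^ (2 * k)"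
      using q by (intro mult_less_le_imp_less) auto
    also have "\<dots> = Q\<^sup>2"
    proof -
      have "4 + 2 * (2 * k) = 2 * (k + 2 - 1) * 2" by simp
      then show ?thesis unfolding Q_def k by (simp only: power_add[symmetric] power_mult[symmetric])
    qed
    finally show ?thesis by (simp add: k)
  qed
  have "sin \<theta> \<ge> 0" using \<theta>b by (intro sin_ge_zero)
  have "1 < (sin \<theta> * Q)\<^sup>2"
  proof -
    have "(sin \<theta>)\<^sup>2 \<noteq> 0" using gap sin2 by auto
    then have "(sin \<theta>)\<^sup>2 * (4 * q * real (q + 1) ^ (2 * (p - 2))) < (sin \<theta>)\<^sup>2 * Q\<^sup>2"
      using big by (intro mult_strict_left_mono) auto
    moreover have "1 \<le> (sin \<theta>)\<^sup>2 * (4 * q * real (q + 1) ^ (2 * (p - 2)))"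
      using gap unfolding sin2[symmetric] by (simp add: mult_ac)
    ultimately show ?thesis by (simp add: power_mult_distrib)
  qed
  then have "1 < sin \<theta> * Q"
    using \<open>sin \<theta> \<ge> 0\<close> Q0 power_less_imp_less_base[of 1 2 "sin \<theta> * Q"] by simp
  then have sinQ: "1 / Q < sin \<theta>" using Q0 by (simp add: field_simps)
  have "real (2 * (p - 1)) = 2 * (real p - 1)" using assms by (simp add: of_nat_diff)
  then have "real q powr (- (2 * (real p - 1))) = 1 / real q powr (real (2 * (p - 1)))"
    by (simp only: powr_minus_divide)
  also have "\<dots> = 1 / Q" unfolding Q_def using q by (subst powr_realpow) auto
  finally have pw: "real q powr (- (2 * (real p - 1))) = 1 / Q" .
  \<comment> \<open>The sine is symmetric about pi / 2, so one lower bound for it serves both ends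
    of the interval.\<close>
  have "sin \<theta> \<le> \<theta>" using \<theta>b by (intro sin_x_le_x)
  moreover have "sin \<theta> \<le> pi - \<theta>" using sin_x_le_x[of "pi - \<theta>"] \<theta>b by simp
  ultimately show ?thesis using sinQ \<theta>b unfolding q_def[symmetric] \<theta>_def[symmetric] pw by auto
qed

end
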